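(* Let $k,r\ge 2$ be integers with $k\le r$, let $\Gamma$ be the symmetric graph of type $k$ and order $r$ with vertex set $\mathcal V$, and put $Q=(r-1)(k-1)$. The Abel transform $\mathcal A:\mathcal D(\mathcal V)^{\sharp}\to\mathcal D(\mathbb Z)_{\mathrm{even}}$ is a (linear) isomorphism, and its inverse is given, for $g\in\mathcal D(\mathbb Z)_{\mathrm{even}}$ and $n\in\mathbb N$, by $$\mathcal{A}^{-1}g(n)=\frac{1}{k}\,Q^{-\frac{n-1}{2}}\Big\{\sum_{m=1}^{\infty}Q^{-\frac{m}{2}}\,[g(n+m-1)-g(n+m+1)]+\sum^{\infty}_{m=1}(-1)^{m-1}(k-1)^m Q^{-\frac{m}{2}}[g(n+m-1)-g(n+m+1)]\Big\},$$ which is equivalent to the following expression: $$\mathcal{A}^{-1}g(n)=Q^{-\frac{n}{2}}\Big\{g(n)-(k-2)\,Q^{-\frac12}\,g(n+1)-\frac{Q-1}{k}\sum_{m=2}^{\infty}Q^{-\frac{m}{2}}\,g(n+m)-\frac{r-k}{k}\sum_{m=2}^{\infty}(-1)^m(k-1)^m\,Q^{-\frac{m}{2}}\,g(n+m)\Big\}.$$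
   Context: Symmetric graph: $\Gamma$ is a connected graph in which every vertex $v$ belongs to exactly $r$ polygons with $k$ sides each (for $k=2$ a polygon is a single edge), these polygons having no side and no vertex in common except $v$, and such that every nontrivial loop runs through all the edges of at least one polygon. $\mathcal V$ is its vertex set (identified with a group $G$ acting isometrically and simply transitively on $\Gamma$). The distance $d(x,y)$ is the minimal number of polygons crossed by a path connecting $x$ with $y$. Fix an origin $o\in\mathcal V$ and put $|x|=d(x,o)$. Boundary: $\Omega$ is the set of geodesic rays starting at $o$; a ray $\omega$ is identified with its sequence of nodes $\omega_0=o,\omega_1,\omega_2,\dots$ in $\mathcal V$, with $d(\omega_i,\omega_j)=|i-j|$. The Busemann function is $\zeta(x,\omega)=d(o,\omega_m)-d(x,\omega_m)$ for $m>|x|$ (independent of such $m$), and the horocycles are $H_h(\omega)=\{x\in\mathcal V:\zeta(x,\omega)=h\}$ for $h\in\mathbb Z$. Functions: $\mathcal D(X)$ is the space of finitely supported complex functions on a discrete space $X$. A function on $\mathcal V$ is radial if it depends only on $|x|$, and then $f(n)$ denotes the common value of $f(x)$ for $|x|=n$; $\mathcal D(\mathcal V)^{\sharp}$ is the space of finitely supported radial functions; $\mathcal D(\mathbb Z)_{\mathrm{even}}$ is the space of finitely supported even functions on $\mathbb Z$. Abel transform: for $f\in\mathcal D(\mathcal V)^{\sharp}$ and $h\in\mathbb Z$, $\mathcal A f(h)=Q^{h/2}\sum_{x\in H_h(\omega)}f(x)$, which is independent of $\omega\in\Omega$ and even in $h$. All the sums in the claim are finite for finitely supported $g$. *)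

theory Defs
  imports "HOL-Analysis.Analysis"
begin

text \<open>A graph is given by its vertex set \<open>V\<close> and its set \<open>E\<close> of undirected edges, each a
  two-element subset of \<open>V\<close>. Walks are lists of vertices.\<close>

definition simple_graph :: "'v set \<Rightarrow> 'v set set \<Rightarrow> bool" where
  "simple_graph V E \<longleftrightarrow> (\<forall>e\<in>E. \<exists>u v. u \<in> V \<and> v \<in> V \<and> u \<noteq> v \<and> e = {u, v})"

definition walk_edges :: "'v list \<Rightarrow> 'v set set" where
  "walk_edges w = {{w ! i, w ! Suc i} | i. Suc i < length w}"

definition walk :: "'v set \<Rightarrow> 'v set set \<Rightarrow> 'v list \<Rightarrow> bool" where
  "walk V E w \<longleftrightarrow> w \<noteq> [] \<and> set w \<subseteq> V \<and> walk_edges w \<subseteq> E"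

definition walk_betw :: "'v set \<Rightarrow> 'v set set \<Rightarrow> 'v \<Rightarrow> 'v list \<Rightarrow> 'v \<Rightarrow> bool" where
  "walk_betw V E x w y \<longleftrightarrow> walk V E w \<and> hd w = x \<and> last w = y"

definition connected_graph :: "'v set \<Rightarrow> 'v set set \<Rightarrow> bool" where
  "connected_graph V E \<longleftrightarrow> V \<noteq> {} \<and> (\<forall>x\<in>V. \<forall>y\<in>V. \<exists>w. walk_betw V E x w y)"

text \<open>A polygon is identified with its set of sides, and its vertices are the elements of its
  union. For \<open>k = 2\<close> the closed walk \<open>[u, v, u]\<close> has only one edge, so the polygons are then
  exactly the singletons \<open>{e}\<close> with \<open>e \<in> E\<close>.\<close>

definition polygons :: "nat \<Rightarrow> 'v set set \<Rightarrow> 'v set set set" where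
  "polygons k E = {walk_edges (xs @ [hd xs]) | xs.
     length xs = k \<and> distinct xs \<and> walk_edges (xs @ [hd xs]) \<subseteq> E}"

text \<open>A loop is nontrivial if it is not a point and does not backtrack. An arbitrary loop that
  does not contract to a point reduces to such a loop by deleting backtrackings, and
  this only removes edges.\<close>

definition nontrivial_loop :: "'v set \<Rightarrow> 'v set set \<Rightarrow> 'v list \<Rightarrow> bool" where
  "nontrivial_loop V E w \<longleftrightarrow> walk V E w \<and> 1 < length w \<and> hd w = last w \<and>
     (\<forall>i. Suc (Suc i) < length w \<longrightarrow> w ! i \<noteq> w ! Suc (Suc i))"

text \<open>Two points are implicit in the usual wording of the following definition. First, the graph
  has no edges other than the sides of its polygons. Second, for \<open>k = 2\<close> a polygon is an edge
  run through back and forth, so that the condition on loops excludes nontrivial loops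
  altogether and the graph is the homogeneous tree of degree \<open>r\<close>; containment of
  edge sets alone would impose nothing in this case.\<close>

definition symmetric_graph :: "nat \<Rightarrow> nat \<Rightarrow> 'v set \<Rightarrow> 'v set set \<Rightarrow> bool" where
  "symmetric_graph k r V E \<longleftrightarrow>
     simple_graph V E \<and> connected_graph V E \<and> \<Union> (polygons k E) = E \<and>
     (\<forall>v\<in>V. card {P \<in> polygons k E. v \<in> \<Union> P} = r) \<and>
     (\<forall>v\<in>V. \<forall>P\<in>polygons k E. \<forall>P'\<in>polygons k E.
        v \<in> \<Union> P \<and> v \<in> \<Union> P' \<and> P \<noteq> P' \<longrightarrow> P \<inter> P' = {} \<and> \<Union> P \<inter> \<Union> P' = {v}) \<and>
     (\<forall>w. nontrivial_loop V E w \<longrightarrow> k \<noteq> 2 \<and> (\<exists>P\<in>polygons k E. P \<subseteq> walk_edges w))"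

definition pdist :: "nat \<Rightarrow> 'v set \<Rightarrow> 'v set set \<Rightarrow> 'v \<Rightarrow> 'v \<Rightarrow> nat" where
  "pdist k V E x y = (LEAST n. \<exists>w. walk_betw V E x w y \<and>
     n = card {P \<in> polygons k E. P \<inter> walk_edges w \<noteq> {}})"

definition rays :: "nat \<Rightarrow> 'v set \<Rightarrow> 'v set set \<Rightarrow> 'v \<Rightarrow> (nat \<Rightarrow> 'v) set" where
  "rays k V E x0 = {\<omega>. range \<omega> \<subseteq> V \<and> \<omega> 0 = x0 \<and>
     (\<forall>i j. int (pdist k V E (\<omega> i) (\<omega> j)) = \<bar>int i - int j\<bar>)}"

text \<open>The difference defining the Busemann function is the same for all \<open>m\<close> larger than the
  distance of \<open>x\<close> from the origin \<open>x0\<close>; the least such \<open>m\<close> is used.\<close>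

definition busemann :: "nat \<Rightarrow> 'v set \<Rightarrow> 'v set set \<Rightarrow> 'v \<Rightarrow> 'v \<Rightarrow> (nat \<Rightarrow> 'v) \<Rightarrow> int" where
  "busemann k V E x0 x \<omega> = (let m = Suc (pdist k V E x x0) in
     int (pdist k V E x0 (\<omega> m)) - int (pdist k V E x (\<omega> m)))"

definition horocycle ::
  "nat \<Rightarrow> 'v set \<Rightarrow> 'v set set \<Rightarrow> 'v \<Rightarrow> (nat \<Rightarrow> 'v) \<Rightarrow> int \<Rightarrow> 'v set" where
  "horocycle k V E x0 \<omega> h = {x \<in> V. busemann k V E x0 x \<omega> = h}"

text \<open>Functions on a set \<open>X\<close> are extended by zero outside \<open>X\<close>.\<close>

definition fin_supp_funs :: "'a set \<Rightarrow> ('a \<Rightarrow> complex) set" where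
  "fin_supp_funs X = {f. finite {x. f x \<noteq> 0} \<and> {x. f x \<noteq> 0} \<subseteq> X}"

definition radial_funs ::
  "nat \<Rightarrow> 'v set \<Rightarrow> 'v set set \<Rightarrow> 'v \<Rightarrow> ('v \<Rightarrow> complex) set" where
  "radial_funs k V E x0 = {f \<in> fin_supp_funs V.
     \<forall>x\<in>V. \<forall>y\<in>V. pdist k V E x x0 = pdist k V E y x0 \<longrightarrow> f x = f y}"

definition even_funs :: "(int \<Rightarrow> complex) set" where
  "even_funs = {g \<in> fin_supp_funs UNIV. \<forall>h. g (- h) = g h}"

definition radial_value ::
  "nat \<Rightarrow> 'v set \<Rightarrow> 'v set set \<Rightarrow> 'v \<Rightarrow> ('v \<Rightarrow> complex) \<Rightarrow> nat \<Rightarrow> complex" where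
  "radial_value k V E x0 f n = (THE c. \<forall>x\<in>V. pdist k V E x x0 = n \<longrightarrow> f x = c)"

definition abel ::
  "nat \<Rightarrow> nat \<Rightarrow> 'v set \<Rightarrow> 'v set set \<Rightarrow> 'v \<Rightarrow> (nat \<Rightarrow> 'v) \<Rightarrow> ('v \<Rightarrow> complex) \<Rightarrow> int \<Rightarrow> complex" where
  "abel k r V E x0 \<omega> f h =
     complex_of_real (((real r - 1) * (real k - 1)) powr (real_of_int h / 2)) *
     (\<Sum>\<^sub>\<infinity>x\<in>horocycle k V E x0 \<omega> h. f x)"

end

theory Submission
  imports Defs
begin

text \<open>Removing the sides of a polygon \<open>P\<close> leaves every vertex \<open>x\<close> connected to exactly one vertex of
  \<open>P\<close>, its gate; otherwise there would be a nontrivial loop containing no polygon. The distance of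
  \<open>x\<close> and \<open>y\<close> is the number of polygons at which they have different gates, so the graph is treated
  as a tree of polygons. Every \<open>y \<noteq> t\<close> lies on exactly one polygon with gate of \<open>t\<close> different from
  \<open>y\<close>. Comparing these polygons for \<open>t = x0\<close> and for \<open>t\<close> far out on the ray gives a recursion for
  the number \<open>N(n,h)\<close> of vertices on the sphere of radius \<open>n\<close> and the horocycle \<open>h\<close>. It implies
  \<open>N(n,-h) = Q^h N(n,h)\<close>, which makes the Abel transform even, and, for \<open>h \<ge> 0\<close>,
  \<open>N(n,h) - Q N(n,h+2) = [n=h] + (k-2)[n=h+1] - (k-1)[n=h+2]\<close>. With \<open>S\<close> the shift and
  \<open>F(h) = Q^(-h/2) g(h)\<close>, the equation \<open>A f = g\<close> becomes \<open>(1 - S)(1 + (k-1)S) f = (1 - Q S^2) F\<close>, which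
  has a unique finitely supported solution. Partial fractions yield both formulas for it.\<close>

section \<open>Walks and polygons\<close>

lemma walk_edges_Nil [simp]: "walk_edges [] = {}"
  and walk_edges_single [simp]: "walk_edges [x] = {}"
  by (auto simp: walk_edges_def)

lemma walk_edges_Cons [simp]: "walk_edges (x # y # zs) = insert {x, y} (walk_edges (y # zs))"
proof -
  have "{i. Suc i < length (x # y # zs)} = insert 0 (Suc ` {i. Suc i < length (y # zs)})"
    by (auto simp: image_iff) (metis Suc_less_eq not0_implies_Suc)
  moreover have "walk_edges w = (\<lambda>i. {w ! i, w ! Suc i}) ` {i. Suc i < length w}" for w :: "'a list"
    by (auto simp: walk_edges_def)
  ultimately show ?thesis
    by (simp add: image_image)
qed

lemma walk_edges_append:
  "walk_edges (xs @ u # ys) = walk_edges (xs @ [u]) \<union> walk_edges (u # ys)"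
proof (induction xs)
  case (Cons x xs)
  then show ?case by (cases xs) auto
qed simp

lemma walk_edges_subset_set: "e \<in> walk_edges w \<Longrightarrow> e \<subseteq> set w"
  by (auto simp: walk_edges_def)

lemma Union_walk_edges: "2 \<le> length w \<Longrightarrow> \<Union> (walk_edges w) = set w"
proof (induction w)
  case (Cons x w)
  show ?case
  proof (cases w)
    case (Cons y zs)
    then show ?thesis using Cons.IH by (cases zs) auto
  qed (use Cons.prems in simp)
qed simp

lemma finite_walk_edges [simp]: "finite (walk_edges w)"
proof (induction w)
  case (Cons x w)
  then show ?case by (cases w) auto
qed simp

lemma walk_edge_at_start:
  assumes "distinct (q # c # cs)" "{q, z} \<in> walk_edges (q # c # cs)"
  shows "z = c"
  using assms walk_edges_subset_set[of "{q, z}" "c # cs"] by (auto simp: doubleton_eq_iff)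

text \<open>Along the walk, the first vertex covered by \<open>S\<close> has no earlier edge in
  \<open>S\<close>, and distinctness leaves just one further edge at it. Hence a path cannot contain
  a polygon with at least three sides, where every vertex lies on two sides.\<close>

lemma distinct_walk_has_end_edge:
  assumes "distinct w" "S \<subseteq> walk_edges w" "S \<noteq> {}"
  shows "\<exists>v\<in>\<Union> S. \<forall>e\<in>S. \<forall>e'\<in>S. v \<in> e \<and> v \<in> e' \<longrightarrow> e = e'"
  using assms
proof (induction w)
  case (Cons a w)
  then obtain b zs where w: "w = b # zs"
    by (cases w) auto
  have edge_a: "e = {a, b}" if "e \<in> S" "a \<in> e" for e
    using that Cons.prems walk_edges_subset_set[of e "b # zs"] by (auto simp: w)
  show ?case
  proof (cases "a \<in> \<Union> S")
    case True
    then show ?thesis using edge_a by blast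
  next
    case False
    then have "S \<subseteq> walk_edges w"
      using Cons.prems by (auto simp: w)
    then show ?thesis using Cons by simp
  qed
qed simp

text \<open>Entries two apart could coincide only through the closing vertex \<open>x\<close>, and
  the bound on \<open>length ys\<close> excludes the loop \<open>[x, y, x]\<close>.\<close>

lemma closed_path_no_backtrack:
  assumes "distinct (x # ys)" "2 \<le> length ys" "Suc (Suc i) < length (x # ys @ [x])"
  shows "(x # ys @ [x]) ! i \<noteq> (x # ys @ [x]) ! Suc (Suc i)"
proof
  let ?L = "x # ys"
  assume eq: "(x # ys @ [x]) ! i = (x # ys @ [x]) ! Suc (Suc i)"
  have i: "i < length ?L" "Suc i \<le> length ys"
    using assms by auto
  have nth: "(x # ys @ [x]) ! j = (if j < length ?L then ?L ! j else x)"
    if "j \<le> length ?L" for j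
    using that by (metis Cons_eq_appendI append_Nil le_neq_implies_less nth_append nth_append_length)
  show False
  proof (cases "Suc (Suc i) < length ?L")
    case True
    then have "?L ! i = ?L ! Suc (Suc i)"
      using eq nth[of i] nth[of "Suc (Suc i)"] i by simp
    then show False
      using nth_eq_iff_index_eq[OF assms(1) i(1) True] by simp
  next
    case False
    then have "?L ! i = ?L ! 0"
      using eq nth[of i] nth[of "Suc (Suc i)"] i by (simp split: if_splits)
    then have "i = 0"
      using nth_eq_iff_index_eq[OF assms(1) i(1), of 0] by simp
    then show False using False assms(2) by simp
  qed
qed

lemma polygon_list:
  assumes "P \<in> polygons k E" "v \<in> \<Union> P" "2 \<le> k"
  obtains xs where "length (v # xs) = k" "distinct (v # xs)" "P = walk_edges (v # xs @ [v])"
proof -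
  obtain ys where ys: "length ys = k" "distinct ys" "P = walk_edges (ys @ [hd ys])"
    using assms(1) by (auto simp: polygons_def)
  then have "ys \<noteq> []"
    using assms(3) by auto
  then have "v \<in> set ys"
    using ys assms Union_walk_edges[of "ys @ [hd ys]"] hd_in_set[of ys] by auto
  then obtain as bs where split: "ys = as @ v # bs"
    by (meson split_list)
  \<comment> \<open>The cyclic list is rotated to start at \<open>v\<close>; both closed walks
    consist of the same two arcs.\<close>
  have "P = walk_edges (v # (bs @ as) @ [v])"
  proof (cases as)
    case (Cons a as')
    then have "P = walk_edges (as @ [v]) \<union> walk_edges (v # bs @ [a])"
      using ys(3) walk_edges_append[of as v "bs @ [a]"] by (simp add: split)
    moreover have "walk_edges (v # bs @ as @ [v]) = walk_edges (v # bs @ [a]) \<union> walk_edges (as @ [v])"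
      using walk_edges_append[of "v # bs" a "as' @ [v]"] by (simp add: Cons)
    ultimately show ?thesis by (simp add: Un_commute)
  qed (use ys(3) in \<open>simp add: split\<close>)
  then show ?thesis
    using that[of "bs @ as"] ys split by auto
qed

lemma card_Union_polygon:
  assumes "P \<in> polygons k E" "2 \<le> k"
  shows "finite (\<Union> P)" "card (\<Union> P) = k"
proof -
  obtain ys where ys: "length ys = k" "distinct ys" "P = walk_edges (ys @ [hd ys])"
    using assms(1) by (auto simp: polygons_def)
  moreover have "ys \<noteq> []"
    using ys(1) assms(2) by auto
  ultimately have "\<Union> P = set ys"
    using assms Union_walk_edges[of "ys @ [hd ys]"] hd_in_set[of ys] by auto
  then show "finite (\<Union> P)" "card (\<Union> P) = k"
    using ys distinct_card by auto
qed

lemma polygon_arc: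
  assumes "P \<in> polygons k E" "p \<in> \<Union> P" "q \<in> \<Union> P" "2 \<le> k"
  obtains w where "w \<noteq> []" "hd w = p" "last w = q" "walk_edges w \<subseteq> P"
proof -
  obtain xs where xs: "length (p # xs) = k" "distinct (p # xs)" "P = walk_edges (p # xs @ [p])"
    using polygon_list assms by metis
  then have "q \<in> set (p # xs)"
    using assms Union_walk_edges[of "p # xs @ [p]"] by auto
  then obtain as bs where split: "p # xs = as @ q # bs"
    by (meson split_list)
  have "P = walk_edges (as @ [q]) \<union> walk_edges (q # bs @ [p])"
    using xs(3) split walk_edges_append[of as q "bs @ [p]"]
    by (metis append_Cons append_assoc)
  moreover have "hd (as @ [q]) = p"
    using split by (cases as) auto
  ultimately show ?thesis
    using that[of "as @ [q]"] by auto
qed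

text \<open>The two neighbours of \<open>v\<close> on the cycle differ once there are three
  vertices; for \<open>k = 2\<close> the polygon is a single edge.\<close>

lemma polygon_two_edges:
  assumes "P \<in> polygons k E" "v \<in> \<Union> P" "3 \<le> k"
  obtains e e' where "e \<in> P" "e' \<in> P" "v \<in> e" "v \<in> e'" "e \<noteq> e'"
proof -
  obtain xs where xs: "length (v # xs) = k" "distinct (v # xs)" "P = walk_edges (v # xs @ [v])"
    using polygon_list[OF assms(1,2)] assms(3) by auto
  then obtain c cs where c: "xs = c # cs" "cs \<noteq> []"
    using assms(3) by (cases xs) (auto simp: Suc_le_eq)
  then obtain ds d where d: "cs = ds @ [d]"
    by (meson rev_exhaust)
  have "{v, c} \<in> P"
    using xs c by simp
  moreover have "{v, d} \<in> P"
    using xs c d walk_edges_append[of "v # c # ds" d "[v]"] by (auto simp: insert_commute)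
  moreover have "c \<noteq> d"
    using xs c d by auto
  ultimately show ?thesis
    using that[of "{v, c}" "{v, d}"] by (auto simp: doubleton_eq_iff)
qed

text \<open>Used with \<open>F = E\<close> and, after cutting out the sides of a polygon
  \<open>P\<close>, with \<open>F = E - P\<close>. Edges are removed but no vertices, so the
  vertices of \<open>P\<close> remain available as end points.\<close>

definition reach :: "'v set set \<Rightarrow> 'v \<Rightarrow> 'v \<Rightarrow> bool" where
  "reach F = (\<lambda>u v. {u, v} \<in> F)\<^sup>*\<^sup>*"

lemma reach_refl [simp]: "reach F x x"
  by (simp add: reach_def)

lemma reach_step: "reach F x y \<Longrightarrow> {y, z} \<in> F \<Longrightarrow> reach F x z"
  unfolding reach_def by (rule rtranclp.rtrancl_into_rtrancl)

lemma reach_trans: "reach F x y \<Longrightarrow> reach F y z \<Longrightarrow> reach F x z"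
  unfolding reach_def by (rule rtranclp_trans)

lemma reach_sym: "reach F x y \<Longrightarrow> reach F y x"
  unfolding reach_def
  by (rule sympD[OF symp_rtranclp]) (auto simp: symp_def insert_commute)

lemma reach_mono: "reach F x y \<Longrightarrow> F \<subseteq> F' \<Longrightarrow> reach F' x y"
  unfolding reach_def by (rule rtranclp_mono[THEN predicate2D]) auto

lemma reach_induct [consumes 1, case_names refl step]:
  assumes "reach F x y" "P x" "\<And>y z. reach F x y \<Longrightarrow> {y, z} \<in> F \<Longrightarrow> P y \<Longrightarrow> P z"
  shows "P y"
  using assms(1) unfolding reach_def
  by (induction rule: rtranclp_induct) (use assms(2,3) in \<open>auto simp: reach_def\<close>)

lemma reach_iff_walk:
  "reach F x y \<longleftrightarrow> (\<exists>w. w \<noteq> [] \<and> hd w = x \<and> last w = y \<and> walk_edges w \<subseteq> F)"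
proof
  assume "reach F x y"
  then show "\<exists>w. w \<noteq> [] \<and> hd w = x \<and> last w = y \<and> walk_edges w \<subseteq> F"
  proof (induction rule: reach_induct)
    case refl
    show ?case by (rule exI[of _ "[x]"]) simp
  next
    case (step y z)
    then obtain w where w: "w \<noteq> []" "hd w = x" "last w = y" "walk_edges w \<subseteq> F"
      by blast
    then have "walk_edges (w @ [z]) \<subseteq> F"
      using walk_edges_append[of "butlast w" y "[z]"] append_butlast_last_id[of w] step.hyps(2)
      by (metis (no_types, lifting) Un_subset_iff append_Cons append_Nil append_assoc
          empty_subsetI insert_subset walk_edges_Cons walk_edges_single)
    then show ?case
      using w by (intro exI[of _ "w @ [z]"]) simp
  qed
next
  have "reach F (hd w) (last w)" if "w \<noteq> []" "walk_edges w \<subseteq> F" for w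
    using that
  proof (induction w rule: rev_nonempty_induct)
    case (snoc z w)
    then obtain w' y where w': "w = w' @ [y]"
      by (meson rev_exhaust)
    have "walk_edges (w @ [z]) = insert {y, z} (walk_edges w)"
      using walk_edges_append[of w' y "[z]"] by (auto simp: w')
    moreover have "hd (w @ [z]) = hd w"
      by (cases w') (simp_all add: w')
    ultimately show ?case
      using snoc by (auto simp: w' intro: reach_step)
  qed simp
  then show "\<exists>w. w \<noteq> [] \<and> hd w = x \<and> last w = y \<and> walk_edges w \<subseteq> F \<Longrightarrow> reach F x y"
    by blast
qed

section \<open>Polygons in a symmetric graph\<close>

locale polygon_graph =
  fixes k r :: nat and V :: "'v set" and E :: "'v set set"
  assumes k2: "2 \<le> k" and r2: "2 \<le> r" and symmetric: "symmetric_graph k r V E"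
begin

abbreviation polys :: "'v set set set" where
  "polys \<equiv> polygons k E"

lemmas symmetric_unfolded = symmetric[unfolded symmetric_graph_def]
lemmas simple = symmetric_unfolded[THEN conjunct1]
lemmas connected_VE = symmetric_unfolded[THEN conjunct2, THEN conjunct1]
lemmas Union_polys = symmetric_unfolded[THEN conjunct2, THEN conjunct2, THEN conjunct1]
lemmas card_polys = symmetric_unfolded[THEN conjunct2, THEN conjunct2, THEN conjunct2, THEN conjunct1]
lemmas polys_meet =
  symmetric_unfolded[THEN conjunct2, THEN conjunct2, THEN conjunct2, THEN conjunct2, THEN conjunct1]
lemmas loops =
  symmetric_unfolded[THEN conjunct2, THEN conjunct2, THEN conjunct2, THEN conjunct2, THEN conjunct2]

lemma edges_subset: "e \<in> E \<Longrightarrow> e \<subseteq> V"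
  using simple[unfolded simple_graph_def, rule_format, of e] by auto

lemma polygon_subset: "P \<in> polys \<Longrightarrow> P \<subseteq> E"
  by (auto simp: polygons_def)

lemma polygon_vertices: "P \<in> polys \<Longrightarrow> \<Union> P \<subseteq> V"
  using polygon_subset edges_subset by blast

lemma edge_polygon:
  assumes "e \<in> E" obtains P where "P \<in> polys" "e \<in> P"
  using assms Union_polys by blast

lemma card_polygons_at: "v \<in> V \<Longrightarrow> card {P \<in> polys. v \<in> \<Union> P} = r"
  using card_polys by blast

lemma polygon_common_vertex:
  assumes "P \<in> polys" "P' \<in> polys" "v \<in> \<Union> P" "v \<in> \<Union> P'" "u \<in> \<Union> P" "u \<in> \<Union> P'" "u \<noteq> v"
  shows "P = P'"
proof (rule ccontr)
  assume "P \<noteq> P'"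
  moreover have "v \<in> V"
    using assms polygon_vertices by blast
  ultimately have "\<Union> P \<inter> \<Union> P' = {v}"
    using polys_meet[rule_format, of v P P'] assms(1-4) by simp
  then show False using assms(5-7) by blast
qed

lemma polygon_disjoint:
  assumes "P \<in> polys" "P' \<in> polys" "P \<noteq> P'"
  shows "P \<inter> P' = {}"
proof (rule ccontr)
  assume "P \<inter> P' \<noteq> {}"
  then obtain e where e: "e \<in> P" "e \<in> P'" by blast
  then obtain u v where "e = {u, v}" "u \<noteq> v"
    using polygon_subset[OF assms(1)] simple unfolding simple_graph_def by blast
  then show False
    using polygon_common_vertex[of P P' u v] assms e by blast
qed

lemma connected: "x \<in> V \<Longrightarrow> y \<in> V \<Longrightarrow> reach E x y"
  using connected_VE unfolding connected_graph_def walk_betw_def walk_def reach_iff_walk by blast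

lemma loop_contains_polygon:
  assumes "nontrivial_loop V E w"
  shows "3 \<le> k" "\<exists>P\<in>polys. P \<subseteq> walk_edges w"
proof -
  have *: "k \<noteq> 2 \<and> (\<exists>P\<in>polys. P \<subseteq> walk_edges w)"
    using assms loops by blast
  then show "3 \<le> k" using k2 by linarith
  show "\<exists>P\<in>polys. P \<subseteq> walk_edges w" using * by blast
qed

text \<open>A shortest path joining two vertices of a polygon outside this polygon would, together with an
  arc of the polygon, form a loop containing no polygon.\<close>

lemma polygon_separates:
  assumes P: "P \<in> polys" and "p \<in> \<Union> P" "q \<in> \<Union> P" "reach (E - P) p q"
  shows "p = q"
proof (rule ccontr)
  assume "p \<noteq> q"
  \<comment> \<open>\<open>S\<close> describes the counterexamples: walks off \<open>P\<close>
    between two different vertices of \<open>P\<close>. A shortest one has no repeated vertex and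
    meets \<open>P\<close> only at its ends.\<close>
  define S where "S w \<longleftrightarrow> w \<noteq> [] \<and> walk_edges w \<subseteq> E - P \<and> hd w \<in> \<Union> P \<and> last w \<in> \<Union> P
    \<and> hd w \<noteq> last w" for w
  obtain w0 where "S w0"
    using assms \<open>p \<noteq> q\<close> unfolding reach_iff_walk S_def by blast
  then obtain w where w: "S w" and least: "\<And>w'. S w' \<Longrightarrow> length w \<le> length w'"
    using ex_has_least_nat[of S w0 length] by blast
  have dist: "distinct w"
  proof (rule ccontr)
    assume "\<not> distinct w"
    then obtain a b c u where d: "w = a @ [u] @ b @ [u] @ c"
      using not_distinct_decomp by blast
    have "walk_edges (a @ u # c) \<subseteq> walk_edges w"
      using walk_edges_append[of a u c] walk_edges_append[of a u "b @ u # c"]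
        walk_edges_append[of "u # b" u c] by (auto simp: d)
    then have "S (a @ u # c)"
      using w by (cases a) (auto simp: S_def d)
    from least[OF this] show False by (simp add: d)
  qed
  obtain p' mid q' where wpq: "w = p' # mid @ [q']"
    using w unfolding S_def
    by (metis append_butlast_last_id hd_Cons_tl last_ConsL last_tl)
  have p'q': "p' \<in> \<Union> P" "q' \<in> \<Union> P" "p' \<noteq> q'"
    using w by (auto simp: S_def wpq)
  have mid: "u \<notin> \<Union> P" if u: "u \<in> set mid" for u
  proof
    assume uP: "u \<in> \<Union> P"
    obtain a b where "mid = a @ u # b"
      using u by (meson split_list)
    moreover have "u \<noteq> p'" using dist u by (auto simp: wpq)
    ultimately have "S (p' # a @ [u])"
      using w uP p'q' walk_edges_append[of "p' # a" u "b @ [q']"] by (auto simp: S_def wpq)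
    from least[OF this] show False by (simp add: wpq \<open>mid = a @ u # b\<close>)
  qed
  obtain xs where xs: "length (q' # xs) = k" "distinct (q' # xs)" "P = walk_edges (q' # xs @ [q'])"
    using polygon_list[OF P p'q'(2) k2] by blast
  have UP: "\<Union> P = set (q' # xs)"
    using Union_walk_edges[of "q' # xs @ [q']"] xs(3) by auto
  then have "p' \<in> set xs" using p'q' by auto
  then obtain as bs where asbs: "xs = as @ p' # bs"
    by (meson split_list)
  \<comment> \<open>The loop follows the shortest walk from \<open>p'\<close> to \<open>q'\<close>
    and returns along the arc \<open>as\<close> of \<open>P\<close>.\<close>
  let ?ys = "mid @ q' # as"
  let ?L = "p' # ?ys @ [p']"
  have L_edges: "walk_edges ?L = walk_edges w \<union> walk_edges (q' # as @ [p'])"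
    using walk_edges_append[of "p' # mid" q' "as @ [p']"] by (simp add: wpq)
  have arc: "walk_edges (q' # as @ [p']) \<subseteq> walk_edges (q' # xs)"
    using walk_edges_append[of "q' # as" p' bs] by (auto simp: asbs)
  have xsP: "walk_edges (q' # xs) \<subseteq> P"
  proof -
    obtain ds d where "xs = ds @ [d]"
      using \<open>p' \<in> set xs\<close> by (cases xs rule: rev_cases) auto
    then show ?thesis
      using xs(3) walk_edges_append[of "q' # ds" d "[q']"] by auto
  qed
  have dL: "distinct (p' # ?ys)"
    using dist xs(2) mid by (auto simp: wpq asbs UP)
  \<comment> \<open>A single edge from \<open>p'\<close> to \<open>q'\<close> would belong to a
    second polygon sharing two vertices with \<open>P\<close>.\<close>
  have len: "2 \<le> length ?ys"
  proof (rule ccontr)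
    assume "\<not> 2 \<le> length ?ys"
    then have "w = [p', q']" by (simp add: wpq Suc_le_eq)
    then have e: "{p', q'} \<in> E - P" using w by (auto simp: S_def)
    then obtain P' where "P' \<in> polys" "{p', q'} \<in> P'" using edge_polygon by blast
    then show False
      using polygon_common_vertex[OF P, of P' p' q'] p'q' e by blast
  qed
  have LE: "walk_edges ?L \<subseteq> E"
    using L_edges w arc xsP polygon_subset[OF P] by (auto simp: S_def)
  have "set ?L \<subseteq> V"
    using Union_walk_edges[of ?L] LE edges_subset by fastforce
  then have loop: "nontrivial_loop V E ?L"
    unfolding nontrivial_loop_def walk_def
    using LE closed_path_no_backtrack[OF dL len] by auto
  have k3: "3 \<le> k" using loop_contains_polygon[OF loop] by blast
  obtain P' where P': "P' \<in> polys" "P' \<subseteq> walk_edges ?L"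
    using loop_contains_polygon[OF loop] by blast
  obtain c cs where c: "xs = c # cs" "cs \<noteq> []"
    using k3 xs(1) by (cases xs) (auto simp: Suc_le_eq)
  \<comment> \<open>The loop omits the side of \<open>P\<close> that closes its cycle at
    \<open>q'\<close>. So the polygon \<open>P'\<close> inside the loop differs from
    \<open>P\<close>, shares no side with it and must lie in \<open>w\<close>. There
    \<open>distinct_walk_has_end_edge\<close> contradicts the two sides of \<open>P'\<close> at each
    of its vertices.\<close>
  have "{q', last cs} \<notin> walk_edges (q' # xs)"
    using walk_edge_at_start[of q' c cs "last cs"] xs(2) c by auto
  moreover have "{q', last cs} \<in> P"
  proof -
    obtain ds d where "cs = ds @ [d]"
      using c(2) by (cases cs rule: rev_cases) auto
    then show ?thesis
      using xs(3) c walk_edges_append[of "q' # c # ds" d "[q']"] by (auto simp: insert_commute)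
  qed
  ultimately have "\<not> P \<subseteq> walk_edges ?L"
    using L_edges arc w by (auto simp: S_def)
  then have "P \<noteq> P'" using P' by blast
  then have "P \<inter> P' = {}"
    by (rule polygon_disjoint[OF P P'(1)])
  moreover have "P' \<subseteq> walk_edges w \<union> P"
    using order_trans[OF P'(2)] L_edges order_trans[OF arc xsP] by (simp add: le_supI2)
  ultimately have sub: "P' \<subseteq> walk_edges w"
    by auto
  have "P' \<noteq> {}"
    using card_Union_polygon(2)[OF P'(1) k2] k2 by auto
  from distinct_walk_has_end_edge[OF dist sub this]
  obtain v where v: "v \<in> \<Union> P'" "\<forall>e\<in>P'. \<forall>e'\<in>P'. v \<in> e \<and> v \<in> e' \<longrightarrow> e = e'"
    by (elim bexE) simp
  show False
    using polygon_two_edges[OF P'(1) v(1) k3] v(2) by metis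
qed

end

section \<open>Gates and distances\<close>

text \<open>The first side of \<open>P\<close> used by a path starts at a vertex of
  \<open>P\<close>, and the part of the path before it avoids the sides of \<open>P\<close>.\<close>

lemma reach_until:
  "reach F x y \<Longrightarrow> reach (F - P) x y \<or> (\<exists>p\<in>\<Union> P. reach (F - P) x p)"
proof (induction rule: reach_induct)
  case (step y z)
  then show ?case
    by (cases "{y, z} \<in> P") (auto intro: reach_step)
qed simp

context polygon_graph
begin

text \<open>The projection of \<open>x\<close> onto \<open>P\<close>. Uniqueness comes from
  \<open>polygon_separates\<close>, existence from \<open>reach_until\<close> applied to a path from
  \<open>x\<close> to \<open>P\<close>.\<close>

definition gate :: "'v set set \<Rightarrow> 'v \<Rightarrow> 'v" where
  "gate P x = (THE p. p \<in> \<Union> P \<and> reach (E - P) x p)"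

lemma gateI:
  assumes "P \<in> polys" "p \<in> \<Union> P" "reach (E - P) x p"
  shows "gate P x = p"
  unfolding gate_def
proof (rule the_equality)
  show "p \<in> \<Union> P \<and> reach (E - P) x p"
    using assms(2,3) ..
  show "q = p" if "q \<in> \<Union> P \<and> reach (E - P) x q" for q
    using polygon_separates[OF assms(1)] that assms(2) reach_trans[OF reach_sym assms(3)] by metis
qed

lemma gate:
  assumes "P \<in> polys" "x \<in> V"
  shows gate_in: "gate P x \<in> \<Union> P" and reach_gate: "reach (E - P) x (gate P x)"
proof -
  have "\<Union> P \<noteq> {}"
    using card_Union_polygon(2)[OF assms(1) k2] k2 by (metis card.empty not_numeral_le_zero)
  then obtain q where q: "q \<in> \<Union> P" by blast
  then have "reach E x q"
    using connected[OF assms(2)] polygon_vertices[OF assms(1)] by blast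
  from reach_until[OF this, of P] q obtain p where "p \<in> \<Union> P" "reach (E - P) x p"
    by blast
  then show "gate P x \<in> \<Union> P" "reach (E - P) x (gate P x)"
    using gateI[OF assms(1)] by auto
qed

lemma gate_self: "P \<in> polys \<Longrightarrow> p \<in> \<Union> P \<Longrightarrow> gate P p = p"
  by (simp add: gateI)

lemma gate_reach:
  assumes "P \<in> polys" "y \<in> V" "reach (E - P) x y"
  shows "gate P x = gate P y"
  using assms gate[OF assms(1,2)] gateI reach_trans by metis

lemma reach_in_polygon:
  assumes "P \<in> polys" "p \<in> \<Union> P" "q \<in> \<Union> P"
  shows "reach P p q"
  using polygon_arc[OF assms k2] reach_iff_walk by metis

text \<open>Distinct polygons share no side, so \<open>P'\<close> stays connected after the sides of
  \<open>P\<close> are removed.\<close>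

lemma gate_polygon:
  assumes "P \<in> polys" "P' \<in> polys" "P \<noteq> P'" "p \<in> \<Union> P'" "q \<in> \<Union> P'"
  shows "gate P p = gate P q"
proof (rule gate_reach[OF assms(1)])
  show "reach (E - P) p q"
    using reach_in_polygon[OF assms(2,4,5)] polygon_disjoint[OF assms(1-3)] polygon_subset[OF assms(2)]
    by (blast intro: reach_mono)
  show "q \<in> V" using assms polygon_vertices by blast
qed

text \<open>A path from \<open>z\<close> to its gate in \<open>P'\<close>, off the sides of
  \<open>P'\<close>, either avoids the sides of \<open>P\<close>, and then \<open>z\<close> and
  \<open>P'\<close> have the same gate in \<open>P\<close>; or it meets \<open>P\<close> on the way,
  and then \<open>z\<close> and \<open>P\<close> have the same gate in \<open>P'\<close>. By
  \<open>gate_polygon\<close>, \<open>p\<close> and \<open>p'\<close> may be any vertices of the two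
  polygons.\<close>

lemma gate_alternative:
  assumes "P \<in> polys" "P' \<in> polys" "P \<noteq> P'" "p \<in> \<Union> P" "p' \<in> \<Union> P'" "z \<in> V"
  shows "gate P' z = gate P' p \<or> gate P z = gate P p'"
proof -
  let ?f = "gate P' z"
  have f: "?f \<in> \<Union> P'" "reach (E - P') z ?f"
    using gate[OF assms(2,6)] by auto
  from reach_until[OF f(2), of P] show ?thesis
  proof
    assume "reach (E - P' - P) z ?f"
    then have "gate P z = gate P ?f"
      using gate_reach[OF assms(1)] f(1) polygon_vertices[OF assms(2)]
      by (blast intro: reach_mono)
    also have "\<dots> = gate P p'"
      using gate_polygon[OF assms(1-3) f(1) assms(5)] .
    finally show ?thesis by simp
  next
    assume "\<exists>u\<in>\<Union> P. reach (E - P' - P) z u"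
    then obtain u where u: "u \<in> \<Union> P" "reach (E - P' - P) z u" by blast
    then have "gate P' z = gate P' u"
      using gate_reach[OF assms(2)] polygon_vertices[OF assms(1)]
      by (blast intro: reach_mono)
    also have "\<dots> = gate P' p"
      using gate_polygon[OF assms(2,1) _ u(1) assms(4)] assms(3) by blast
    finally show ?thesis by simp
  qed
qed

text \<open>For different polygons, \<open>gate_alternative\<close> with \<open>p = p' = y\<close>
  forces one of the two gates to be \<open>y\<close>.\<close>

lemma gate_unique_polygon:
  assumes "P \<in> polys" "P' \<in> polys" "y \<in> \<Union> P" "y \<in> \<Union> P'" "z \<in> V" "gate P z \<noteq> y" "gate P' z \<noteq> y"
  shows "P = P'"
  using gate_alternative[OF assms(1,2) _ assms(3,4,5)] assms gate_self by metis

text \<open>The polygon contains the edge by which a path from \<open>x\<close> first arrives at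
  \<open>y\<close>: up to that edge the path avoids \<open>y\<close>, so it enters the polygon at
  another vertex.\<close>

lemma gate_ex_polygon:
  assumes "x \<in> V" "y \<in> V" "x \<noteq> y"
  obtains P where "P \<in> polys" "y \<in> \<Union> P" "gate P x \<noteq> y"
proof -
  let ?F = "{e \<in> E. y \<notin> e}"
  have avoid: "u \<noteq> y" if "reach ?F x u" for u
    using that by (induction rule: reach_induct) (use assms(3) in auto)
  have "reach ?F x u \<or> (\<exists>P\<in>polys. y \<in> \<Union> P \<and> gate P x \<noteq> y)" if "reach E x u" for u
    using that
  proof (induction rule: reach_induct)
    case (step u v)
    show ?case
    proof (cases "reach ?F x u \<and> v = y")
      case True
      then have ruF: "reach ?F x u" and "v = y" by auto
      obtain P where P: "P \<in> polys" "{u, v} \<in> P"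
        using edge_polygon[OF step.hyps(2)] by blast
      from reach_until[OF ruF, of P] P obtain p where p: "p \<in> \<Union> P" "reach (?F - P) x p"
        by blast
      have "gate P x = p"
        using gateI[OF P(1) p(1)] p(2) by (blast intro: reach_mono)
      moreover have "p \<noteq> y"
        using avoid p(2) by (blast intro: reach_mono)
      ultimately show ?thesis
        using P \<open>v = y\<close> by blast
    next
      case False
      then show ?thesis
        using step avoid[of u] by (auto intro: reach_step)
    qed
  qed simp
  then show ?thesis
    using connected[OF assms(1,2)] avoid[of y] that by blast
qed

section \<open>Separating polygons and the distance\<close>

definition sep :: "'v \<Rightarrow> 'v \<Rightarrow> 'v set set set" where
  "sep x y = {P \<in> polys. gate P x \<noteq> gate P y}"

definition crossed :: "'v list \<Rightarrow> 'v set set set" where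
  "crossed w = {P \<in> polys. P \<inter> walk_edges w \<noteq> {}}"

lemma finite_crossed: "finite (crossed w)"
proof -
  have "finite {P \<in> polys. e \<in> P}" for e
  proof (cases "\<exists>P\<in>polys. e \<in> P")
    case True
    then obtain P where P: "P \<in> polys" "e \<in> P" by blast
    have "{P \<in> polys. e \<in> P} \<subseteq> {P}"
      using polygon_disjoint[OF P(1)] P(2) by blast
    then show ?thesis using finite_subset by blast
  next
    case False
    then have "{P \<in> polys. e \<in> P} = {}" by blast
    then show ?thesis by (simp only: finite.emptyI)
  qed
  then have "finite (\<Union>e\<in>walk_edges w. {P \<in> polys. e \<in> P})" by simp
  then show ?thesis
    by (rule rev_finite_subset) (auto simp: crossed_def)
qed

text \<open>A walk using no side of \<open>P\<close> runs in \<open>E - P\<close> and cannot change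
  the gate in \<open>P\<close>. With the converse construction in
  \<open>ex_walk_crossing_sep\<close>, the separating polygons are the unavoidable ones, and
  \<open>dst x y\<close> is their number.\<close>

lemma sep_subset_crossed:
  assumes "walk_betw V E x w y"
  shows "sep x y \<subseteq> crossed w"
proof
  fix P assume P: "P \<in> sep x y"
  have "w \<noteq> []" "hd w = x" "last w = y" "walk_edges w \<subseteq> E" "y \<in> V"
    using assms last_in_set[of w] by (auto simp: walk_betw_def walk_def)
  then have "P \<inter> walk_edges w = {} \<Longrightarrow> reach (E - P) x y"
    unfolding reach_iff_walk by blast
  then show "P \<in> crossed w"
    using P gate_reach[of P y x] \<open>y \<in> V\<close> by (auto simp: sep_def crossed_def)
qed

lemma finite_sep:
  assumes "x \<in> V" "y \<in> V" shows "finite (sep x y)"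
proof -
  obtain w where "walk_betw V E x w y"
    using connected_VE assms unfolding connected_graph_def by blast
  then show ?thesis
    by (rule finite_subset[OF sep_subset_crossed finite_crossed])
qed

text \<open>By \<open>gate_polygon\<close>, moving from \<open>gate P x\<close> to another vertex of
  \<open>P\<close> changes no gate in any other polygon.\<close>

lemma sep_step:
  assumes "P \<in> polys" "x \<in> V" "q \<in> \<Union> P" "q \<noteq> gate P x"
  shows "sep x q = insert P (sep x (gate P x))" "P \<notin> sep x (gate P x)"
proof -
  note g = gate_in[OF assms(1,2)]
  have "gate P' q = gate P' (gate P x)" if "P' \<in> polys" "P' \<noteq> P" for P'
    using gate_polygon[OF that(1) assms(1) that(2) assms(3) g] .
  moreover have "gate P q = q" "gate P (gate P x) = gate P x"
    using gate_self[OF assms(1)] assms(3) g by auto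
  ultimately show "sep x q = insert P (sep x (gate P x))" "P \<notin> sep x (gate P x)"
    using assms unfolding sep_def by auto metis+
qed

lemma sep_refl [simp]: "sep x x = {}"
  by (simp add: sep_def)

lemma ex_walk_crossing_sep:
  assumes "x \<in> V" "y \<in> V"
  shows "\<exists>w. walk_betw V E x w y \<and> crossed w = sep x y"
  using assms(2)
proof (induction "card (sep x y)" arbitrary: y rule: less_induct)
  case less
  show ?case
  proof (cases "x = y")
    case True
    have "walk_betw V E x [x] x" "crossed [x] = {}"
      using assms(1) by (auto simp: walk_betw_def walk_def crossed_def)
    then show ?thesis using True by auto
  next
    case False
    \<comment> \<open>The gate \<open>?g\<close> is separated from \<open>x\<close> by one polygon
      fewer than \<open>y\<close>. The walk to \<open>?g\<close> from the induction hypothesis is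
      continued by an arc inside \<open>P\<close>, which crosses no other polygon.\<close>
    obtain P where P: "P \<in> polys" "y \<in> \<Union> P" "gate P x \<noteq> y"
      using gate_ex_polygon[OF assms(1) less.prems False] by blast
    let ?g = "gate P x"
    have g: "?g \<in> \<Union> P" "?g \<in> V"
      using gate_in[OF P(1) assms(1)] polygon_vertices[OF P(1)] by auto
    note step = sep_step[OF P(1) assms(1) P(2) P(3)[symmetric]]
    have "card (sep x ?g) < card (sep x y)"
      using step finite_sep[OF assms(1) g(2)] by simp
    from less.hyps[OF this g(2)] obtain w
      where w: "walk_betw V E x w ?g" "crossed w = sep x ?g" by blast
    obtain v where v: "v \<noteq> []" "hd v = ?g" "last v = y" "walk_edges v \<subseteq> P"
      using polygon_arc[OF P(1) g(1) P(2) k2] by blast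
    obtain w' where w': "w = w' @ [?g]"
      using w(1) by (metis append_butlast_last_id walk_betw_def walk_def)
    obtain v' where v': "v = ?g # v'"
      using v(1,2) by (cases v) auto
    have v'ne: "v' \<noteq> []"
      using v(3) P(3) by (auto simp: v')
    have edges: "walk_edges (w' @ v) = walk_edges w \<union> walk_edges v"
      using walk_edges_append[of w' ?g v'] by (simp add: w' v')
    have "set v \<subseteq> V"
    proof -
      have "2 \<le> length v" using v'ne by (cases v') (auto simp: v')
      then show ?thesis
        using Union_walk_edges[of v] Union_mono[OF v(4)] polygon_vertices[OF P(1)] by simp
    qed
    moreover have "hd (w' @ v) = x"
      using w(1) by (cases w') (auto simp: w' v' walk_betw_def)
    ultimately have "walk_betw V E x (w' @ v) y"
      using w(1) v polygon_subset[OF P(1)] edges by (auto simp: walk_betw_def walk_def w')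
    moreover have "crossed (w' @ v) \<subseteq> insert P (crossed w)"
      using edges v(4) polygon_disjoint[OF P(1)] by (auto simp: crossed_def)
    ultimately show ?thesis
      using sep_subset_crossed[of x "w' @ v" y] step w(2) by (intro exI[of _ "w' @ v"]) auto
  qed
qed

abbreviation dst :: "'v \<Rightarrow> 'v \<Rightarrow> nat" where
  "dst x y \<equiv> pdist k V E x y"

lemma pdist_eq_card_sep:
  assumes "x \<in> V" "y \<in> V" shows "dst x y = card (sep x y)"
  unfolding pdist_def
proof (rule Least_equality)
  show "\<exists>w. walk_betw V E x w y \<and> card (sep x y) = card {P \<in> polys. P \<inter> walk_edges w \<noteq> {}}"
    using ex_walk_crossing_sep[OF assms] by (fold crossed_def) metis
next
  fix n assume "\<exists>w. walk_betw V E x w y \<and> n = card {P \<in> polys. P \<inter> walk_edges w \<noteq> {}}"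
  then show "card (sep x y) \<le> n"
    using card_mono[OF finite_crossed sep_subset_crossed] by (fold crossed_def) auto
qed

lemma pdist_sym: "x \<in> V \<Longrightarrow> y \<in> V \<Longrightarrow> dst x y = dst y x"
  by (simp add: pdist_eq_card_sep sep_def eq_commute)

lemma pdist_refl [simp]: "x \<in> V \<Longrightarrow> dst x x = 0"
  by (simp add: pdist_eq_card_sep)

lemma pdist_gate:
  assumes "P \<in> polys" "x \<in> V" "q \<in> \<Union> P" "q \<noteq> gate P x"
  shows "dst x q = Suc (dst x (gate P x))"
proof -
  have "q \<in> V" "gate P x \<in> V"
    using assms gate_in[OF assms(1,2)] polygon_vertices by blast+
  then show ?thesis
    using sep_step[OF assms] finite_sep assms(2) by (simp add: pdist_eq_card_sep)
qed

lemma pdist_eq_0_iff: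
  assumes "x \<in> V" "y \<in> V" shows "dst x y = 0 \<longleftrightarrow> x = y"
proof
  assume "dst x y = 0"
  then show "x = y"
    using gate_ex_polygon[OF assms] pdist_gate[OF _ assms(1), of _ y] by (metis nat.distinct(1))
qed (use assms in simp)

lemma gate_pdist:
  assumes "P \<in> polys" "x \<in> V" "p \<in> \<Union> P" "q \<in> \<Union> P" "dst x p < dst x q"
  shows "gate P x = p"
  using pdist_gate[OF assms(1,2,3)] pdist_gate[OF assms(1,2,4)] assms(5) by fastforce

lemma pdist_1_polygon:
  assumes "x \<in> V" "y \<in> V" "dst x y = 1"
  obtains P where "P \<in> polys" "x \<in> \<Union> P" "y \<in> \<Union> P"
proof -
  have "x \<noteq> y" using assms by auto
  then obtain P where P: "P \<in> polys" "y \<in> \<Union> P" "gate P x \<noteq> y"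
    using gate_ex_polygon[OF assms(1,2)] by blast
  then have "dst x (gate P x) = 0"
    using pdist_gate[OF P(1) assms(1) P(2)] assms(3) by auto
  moreover have g: "gate P x \<in> \<Union> P" "gate P x \<in> V"
    using gate_in[OF P(1) assms(1)] polygon_vertices[OF P(1)] by auto
  ultimately show ?thesis
    using pdist_eq_0_iff[OF assms(1) g(2)] P g(1) that by auto
qed

text \<open>Since \<open>sep a b\<close> lies in \<open>sep a y \<union> sep b y\<close>, the
  distances add exactly if no polygon separates both \<open>a\<close> and \<open>b\<close> from
  \<open>y\<close>. One that separates \<open>b\<close> from \<open>y\<close> is \<open>P\<close>
  itself.\<close>

lemma pdist_through:
  assumes "a \<in> V" "b \<in> V" "P \<in> polys" "y \<in> \<Union> P" "gate P b \<noteq> y"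
  shows "dst a b = dst a y + dst b y \<longleftrightarrow> gate P a = y"
proof -
  have y: "y \<in> V" using assms polygon_vertices by blast
  have fin: "finite (sep a y)" "finite (sep b y)"
    using finite_sep assms y by auto
  have sub: "sep a b \<subseteq> sep a y \<union> sep b y"
    by (auto simp: sep_def)
  have card: "card (sep a y \<union> sep b y) + card (sep a y \<inter> sep b y) = dst a y + dst b y"
    using card_Un_Int[OF fin] assms y by (simp add: pdist_eq_card_sep)
  show ?thesis
  proof
    assume "gate P a = y"
    \<comment> \<open>If \<open>P'\<close> separated both, \<open>gate_alternative\<close> for
      \<open>a\<close> would give \<open>P'\<close> the gate \<open>y\<close> in \<open>P\<close>,
      and for \<open>b\<close> it would then give \<open>gate P b = y\<close>.\<close>
    have disj: "sep a y \<inter> sep b y = {}"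
    proof (rule ccontr)
      assume "sep a y \<inter> sep b y \<noteq> {}"
      then obtain P' where P': "P' \<in> polys" "gate P' a \<noteq> gate P' y" "gate P' b \<noteq> gate P' y"
        by (auto simp: sep_def)
      have ne: "P \<noteq> P'"
        using P'(2) gate_self[OF assms(3,4)] \<open>gate P a = y\<close> by auto
      obtain p' where p': "p' \<in> \<Union> P'"
        using gate_in[OF P'(1) y] by blast
      show False
        using gate_alternative[OF assms(3) P'(1) ne assms(4) p' assms(1)]
          gate_alternative[OF assms(3) P'(1) ne assms(4) p' assms(2)] P' \<open>gate P a = y\<close> assms(5)
        by auto
    qed
    then have "sep a b = sep a y \<union> sep b y"
      using sub by (auto simp: sep_def)
    then show "dst a b = dst a y + dst b y"
      using card disj assms by (simp add: pdist_eq_card_sep)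
  next
    assume eq: "dst a b = dst a y + dst b y"
    have "dst a b \<le> card (sep a y \<union> sep b y)"
      using card_mono[OF _ sub] fin assms by (simp add: pdist_eq_card_sep)
    then have "card (sep a y \<inter> sep b y) = 0"
      using card eq by linarith
    then have "sep a y \<inter> sep b y = {}"
      using fin by simp
    then show "gate P a = y"
      using assms(3,5) gate_self[OF assms(3,4)] by (auto simp: sep_def)
  qed
qed

section \<open>Descendants of a vertex with respect to a base vertex\<close>

definition down_polys :: "'v \<Rightarrow> 'v \<Rightarrow> 'v set set set" where
  "down_polys a y = {P \<in> polys. y \<in> \<Union> P \<and> gate P a = y}"

definition children :: "'v \<Rightarrow> 'v \<Rightarrow> 'v set" where
  "children a y = (\<Union>P\<in>down_polys a y. \<Union> P - {y})"

lemma finite_polys_at: "y \<in> V \<Longrightarrow> finite {P \<in> polys. y \<in> \<Union> P}"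
  using card_polygons_at[of y] r2 by (metis (no_types, lifting) card.infinite not_numeral_le_zero)

lemma finite_down_polys: "y \<in> V \<Longrightarrow> finite (down_polys a y)"
  using finite_polys_at by (rule rev_finite_subset) (auto simp: down_polys_def)

text \<open>For \<open>a \<noteq> y\<close>, exactly one of the \<open>r\<close> polygons at
  \<open>y\<close> leads back to \<open>a\<close>, by \<open>gate_ex_polygon\<close> and
  \<open>gate_unique_polygon\<close>.\<close>

lemma card_down_polys:
  assumes "a \<in> V" "y \<in> V"
  shows "card (down_polys a y) = (if a = y then r else r - 1)"
proof (cases "a = y")
  case True
  then have "down_polys a y = {P \<in> polys. y \<in> \<Union> P}"
    using gate_self by (auto simp: down_polys_def)
  then show ?thesis using True card_polygons_at[OF assms(2)] by simp
next
  case False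
  obtain P where P: "P \<in> polys" "y \<in> \<Union> P" "gate P a \<noteq> y"
    using gate_ex_polygon[OF assms False] by blast
  have "P' = P" if "P' \<in> polys" "y \<in> \<Union> P'" "gate P' a \<noteq> y" for P'
    using gate_unique_polygon[OF that(1) P(1) that(2) P(2) assms(1) that(3) P(3)] .
  then have "down_polys a y = {P \<in> polys. y \<in> \<Union> P} - {P}"
    unfolding down_polys_def using P(3) by blast
  then show ?thesis
    using False card_polygons_at[OF assms(2)] finite_polys_at[OF assms(2)] P by simp
qed

lemma children_pdist:
  assumes "a \<in> V" "y \<in> V" "z \<in> children a y"
  shows "z \<in> V" "dst a z = Suc (dst a y)"
  using assms pdist_gate[OF _ assms(1), of _ z] polygon_vertices
  by (auto simp: children_def down_polys_def)

text \<open>The parent of \<open>z\<close> is the gate of \<open>a\<close> in the polygon through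
  which \<open>z\<close> is reached. With \<open>children_disjoint\<close> this partitions the next
  sphere.\<close>

lemma sphere_Suc:
  assumes "a \<in> V"
  shows "{z \<in> V. dst a z = Suc n} = (\<Union>y\<in>{y \<in> V. dst a y = n}. children a y)"
proof
  show "(\<Union>y\<in>{y \<in> V. dst a y = n}. children a y) \<subseteq> {z \<in> V. dst a z = Suc n}"
    using children_pdist[OF assms] by auto
next
  show "{z \<in> V. dst a z = Suc n} \<subseteq> (\<Union>y\<in>{y \<in> V. dst a y = n}. children a y)"
  proof
    fix z assume z: "z \<in> {z \<in> V. dst a z = Suc n}"
    then have "a \<noteq> z" using assms by auto
    then obtain P where P: "P \<in> polys" "z \<in> \<Union> P" "gate P a \<noteq> z"
      using gate_ex_polygon[OF assms] z by blast
    let ?y = "gate P a"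
    have y: "?y \<in> \<Union> P" "?y \<in> V"
      using gate_in[OF P(1) assms] polygon_vertices[OF P(1)] by auto
    have "dst a ?y = n"
      using pdist_gate[OF P(1) assms P(2)] P(3) z by auto
    moreover have "z \<in> children a ?y"
      using P y by (auto simp: children_def down_polys_def)
    ultimately show "z \<in> (\<Union>y\<in>{y \<in> V. dst a y = n}. children a y)"
      using y by blast
  qed
qed

lemma children_disjoint:
  assumes "a \<in> V" "y \<in> V" "y' \<in> V" "y \<noteq> y'"
  shows "children a y \<inter> children a y' = {}"
proof (rule ccontr)
  assume "children a y \<inter> children a y' \<noteq> {}"
  then obtain z P P' where z: "P \<in> down_polys a y" "z \<in> \<Union> P" "z \<noteq> y"
      "P' \<in> down_polys a y'" "z \<in> \<Union> P'" "z \<noteq> y'"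
    by (auto simp: children_def)
  then have "P = P'"
    using gate_unique_polygon[of P P' z a] assms(1) by (auto simp: down_polys_def)
  then show False
    using z assms(4) by (auto simp: down_polys_def)
qed

lemma finite_children: "y \<in> V \<Longrightarrow> finite (children a y)"
  using finite_down_polys card_Union_polygon(1)[OF _ k2]
  by (auto simp: children_def down_polys_def)

lemma finite_sphere: "a \<in> V \<Longrightarrow> finite {z \<in> V. dst a z = n}"
proof (induction n)
  case 0
  then have "{z \<in> V. dst a z = 0} = {a}"
    using pdist_eq_0_iff by auto
  then show ?case by simp
next
  case (Suc n)
  then show ?case
    using finite_children by (simp add: sphere_Suc del: UN_simps)
qed

text \<open>By \<open>pdist_gate\<close>, the vertices of \<open>P\<close> other than the gate of
  \<open>t\<close> are all one step farther from \<open>t\<close> than the gate. The cases are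
  whether or not \<open>y\<close> is that gate.\<close>

lemma card_polygon_level:
  assumes "t \<in> V" "P \<in> polys" "y \<in> \<Union> P"
  shows "card {z \<in> \<Union> P - {y}. dst t z = j} =
    (if gate P t = y then (k - 1) * of_bool (j = Suc (dst t y))
     else of_bool (Suc j = dst t y) + (k - 2) * of_bool (j = dst t y))"
proof -
  note cU = card_Union_polygon[OF assms(2) k2]
  let ?g = "gate P t"
  have g: "?g \<in> \<Union> P" using gate_in[OF assms(2,1)] .
  have dz: "dst t z = Suc (dst t ?g)" if "z \<in> \<Union> P" "z \<noteq> ?g" for z
    using pdist_gate[OF assms(2,1) that] .
  show ?thesis
  proof (cases "?g = y")
    case True
    then have "{z \<in> \<Union> P - {y}. dst t z = j} = (if j = Suc (dst t y) then \<Union> P - {y} else {})"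
      using dz by auto
    then show ?thesis
      using True cU assms(3) by simp
  next
    case False
    have dy: "dst t y = Suc (dst t ?g)" using dz assms(3) False by auto
    have "z \<in> {z \<in> \<Union> P - {y}. dst t z = j} \<longleftrightarrow>
      z \<in> (if Suc j = dst t y then {?g} else if j = dst t y then \<Union> P - {y, ?g} else {})" for z
      using dz[of z] dy g False by (cases "z = ?g"; cases "z \<in> \<Union> P") (simp_all del: Union_iff)
    then have "{z \<in> \<Union> P - {y}. dst t z = j} =
      (if Suc j = dst t y then {?g} else if j = dst t y then \<Union> P - {y, ?g} else {})"
      by (rule set_eqI)
    moreover have "card (\<Union> P - {y, ?g}) = k - 2"
      using cU assms(3) g False by (subst card_Diff_subset) auto
    ultimately show ?thesis
      using False by auto
  qed
qed

text \<open>Children are taken with respect to \<open>a\<close>, distances with respect to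
  \<open>t\<close>. A single polygon \<open>U\<close> at \<open>y\<close> leads towards
  \<open>t\<close>; by \<open>pdist_through\<close> it leads away from \<open>a\<close> exactly when
  \<open>y\<close> lies between \<open>a\<close> and \<open>t\<close>. It then contributes its gate
  and \<open>k - 2\<close> vertices as far from \<open>t\<close> as \<open>y\<close>; all other
  polygons contribute vertices one step farther.\<close>

lemma card_children_level:
  assumes "a \<in> V" "t \<in> V" "y \<in> V" "y \<noteq> t"
  shows "card {z \<in> children a y. dst t z = j} =
    (if dst a t = dst a y + dst t y
     then ((if a = y then r - 1 else r - 2) * (k - 1)) * of_bool (j = Suc (dst t y))
       + of_bool (Suc j = dst t y) + (k - 2) * of_bool (j = dst t y)
     else (r - 1) * (k - 1) * of_bool (j = Suc (dst t y)))"
proof -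
  let ?D = "down_polys a y"
  have fD: "finite ?D" using finite_down_polys[OF assms(3)] .
  obtain U where U: "U \<in> polys" "y \<in> \<Union> U" "gate U t \<noteq> y"
    using gate_ex_polygon[OF assms(2,3)] assms(4) by blast
  have other: "gate P t = y" if "P \<in> ?D" "P \<noteq> U" for P
    using gate_unique_polygon[OF U(1) _ U(2) _ assms(2) U(3)] that by (auto simp: down_polys_def)
  have iff: "dst a t = dst a y + dst t y \<longleftrightarrow> U \<in> ?D"
    using pdist_through[OF assms(1,2) U] U by (auto simp: down_polys_def)
  have "{z \<in> children a y. dst t z = j} = (\<Union>P\<in>?D. {z \<in> \<Union> P - {y}. dst t z = j})"
    by (auto simp: children_def)
  moreover have "card \<dots> = (\<Sum>P\<in>?D. card {z \<in> \<Union> P - {y}. dst t z = j})"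
  proof (rule card_UN_disjoint)
    show "\<forall>P\<in>?D. finite {z \<in> \<Union> P - {y}. dst t z = j}"
    proof
      fix P assume "P \<in> ?D"
      then have "P \<in> polys" by (simp add: down_polys_def)
      from card_Union_polygon(1)[OF this k2] show "finite {z \<in> \<Union> P - {y}. dst t z = j}"
        by (rule rev_finite_subset) blast
    qed
    show "\<forall>P\<in>?D. \<forall>P'\<in>?D. P \<noteq> P' \<longrightarrow>
        {z \<in> \<Union> P - {y}. dst t z = j} \<inter> {z \<in> \<Union> P' - {y}. dst t z = j} = {}"
    proof (intro ballI impI, rule ccontr)
      fix P P' assume "P \<in> ?D" "P' \<in> ?D" "P \<noteq> P'"
        "{z \<in> \<Union> P - {y}. dst t z = j} \<inter> {z \<in> \<Union> P' - {y}. dst t z = j} \<noteq> {}"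
      then show False
        using polygon_common_vertex[of P P' y] unfolding down_polys_def by blast
    qed
  qed (rule fD)
  moreover have level: "card {z \<in> \<Union> P - {y}. dst t z = j} = (if P = U
      then of_bool (Suc j = dst t y) + (k - 2) * of_bool (j = dst t y)
      else (k - 1) * of_bool (j = Suc (dst t y)))" if "P \<in> ?D" for P
    using card_polygon_level[OF assms(2), of P y j] other[OF that] U that
    by (auto simp: down_polys_def)
  ultimately have eq: "card {z \<in> children a y. dst t z = j} = (\<Sum>P\<in>?D. if P = U
      then of_bool (Suc j = dst t y) + (k - 2) * of_bool (j = dst t y)
      else (k - 1) * of_bool (j = Suc (dst t y)))"
    by simp
  show ?thesis
  proof (cases "U \<in> ?D")
    case True
    have "?D = insert U (?D - {U})" using True by blast
    then have "card {z \<in> children a y. dst t z = j} =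
      of_bool (Suc j = dst t y) + (k - 2) * of_bool (j = dst t y)
      + (\<Sum>P\<in>?D - {U}. (k - 1) * of_bool (j = Suc (dst t y)))"
      using eq True fD by (subst (asm) sum.remove[OF fD True]) (simp cong: sum.cong_simp)
    moreover have "card (?D - {U}) = (if a = y then r - 1 else r - 2)"
      using True fD card_down_polys[OF assms(1,3)] by auto
    ultimately show ?thesis
      using True iff by simp
  next
    case False
    then have "card {z \<in> children a y. dst t z = j} = (\<Sum>P\<in>?D. (k - 1) * of_bool (j = Suc (dst t y)))"
      unfolding eq by (intro sum.cong) auto
    moreover have "a \<noteq> y"
      using False U gate_self by (auto simp: down_polys_def)
    ultimately show ?thesis
      using False iff card_down_polys[OF assms(1,3)] by simp
  qed
qed

end

section \<open>Spheres and horocycles\<close>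

locale polygon_graph_ray = polygon_graph k r V E
  for k r :: nat and V :: "'v set" and E :: "'v set set" +
  fixes x0 :: 'v and \<omega> :: "nat \<Rightarrow> 'v"
  assumes x0: "x0 \<in> V" and ray: "\<omega> \<in> rays k V E x0"
begin

lemma ray_in [simp]: "\<omega> n \<in> V"
  and ray_0: "\<omega> 0 = x0"
  and pdist_ray: "int (dst (\<omega> i) (\<omega> j)) = \<bar>int i - int j\<bar>"
  using ray by (auto simp: rays_def)

lemma pdist_origin_ray [simp]: "dst x0 (\<omega> n) = n"
  using pdist_ray[of 0 n] by (simp add: ray_0)

section \<open>The Busemann function of the ray\<close>

abbreviation bus :: "'v \<Rightarrow> int" where
  "bus x \<equiv> busemann k V E x0 x \<omega>"

lemma bus_eq: "x \<in> V \<Longrightarrow> bus x = int (Suc (dst x0 x)) - int (dst (\<omega> (Suc (dst x0 x))) x)"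
  by (simp add: busemann_def pdist_sym[of x x0] pdist_sym[of x "\<omega> _"] x0)

text \<open>The polygon through \<open>\<omega> m\<close> and \<open>\<omega> (Suc m)\<close> is entered from \<open>x0\<close> through \<open>\<omega> m\<close>. If it were entered
  elsewhere from \<open>x\<close>, then \<open>\<omega> m\<close> would lie strictly between \<open>x0\<close> and \<open>x\<close>.\<close>

lemma pdist_ray_Suc:
  assumes "x \<in> V" "dst x0 x \<le> m"
  shows "dst (\<omega> (Suc m)) x = Suc (dst (\<omega> m) x)"
proof -
  have "dst (\<omega> m) (\<omega> (Suc m)) = 1"
    using pdist_ray[of m "Suc m"] by simp
  then obtain P where P: "P \<in> polys" "\<omega> m \<in> \<Union> P" "\<omega> (Suc m) \<in> \<Union> P"
    by (rule pdist_1_polygon[rotated 2]) simp_all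
  have g0: "gate P x0 = \<omega> m"
    by (rule gate_pdist[OF P(1) x0 P(2,3)]) simp
  have ne: "\<omega> (Suc m) \<noteq> \<omega> m"
    using \<open>dst (\<omega> m) (\<omega> (Suc m)) = 1\<close> by auto
  have "gate P x = \<omega> m"
  proof (rule ccontr)
    assume g: "gate P x \<noteq> \<omega> m"
    then have "dst x0 x = m + dst x (\<omega> m)"
      using pdist_through[OF x0 assms(1) P(1,2) g] g0 by simp
    moreover have "x \<noteq> \<omega> m"
      using g gate_self[OF P(1,2)] by auto
    then have "dst x (\<omega> m) \<noteq> 0"
      using pdist_eq_0_iff[OF assms(1)] by simp
    ultimately show False using assms(2) by simp
  qed
  then show ?thesis
    using pdist_gate[OF P(1) assms(1) P(3)] ne assms(1) pdist_sym[of x] by simp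
qed

text \<open>Evaluation one node further than in \<open>bus_eq\<close> measures a vertex at radius
  \<open>n\<close> and its children at radius \<open>n + 1\<close> against the same node
  \<open>\<omega> (n + 2)\<close>.\<close>

lemma bus_eq_Suc:
  assumes "x \<in> V" "dst x0 x = n"
  shows "bus x = int n + 2 - int (dst (\<omega> (n + 2)) x)"
  using bus_eq[OF assms(1)] pdist_ray_Suc[OF assms(1), of "Suc n"] assms(2) by simp

section \<open>Counting the vertices common to a sphere and a horocycle\<close>

definition horo_count :: "nat \<Rightarrow> int \<Rightarrow> nat" where
  "horo_count n h = card {x \<in> V. dst x0 x = n \<and> bus x = h}"

lemma horo_count_0: "horo_count 0 h = of_bool (h = 0)"
proof -
  have "dst (\<omega> 1) x0 = 1"
    using pdist_ray[of 1 0] by (simp add: ray_0)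
  then have "bus x0 = 0"
    using bus_eq[OF x0] x0 by simp
  then have "{x \<in> V. dst x0 x = 0 \<and> bus x = h} = (if h = 0 then {x0} else {})"
    using pdist_eq_0_iff[OF x0] x0 by auto
  then show ?thesis by (simp add: horo_count_def)
qed

lemma card_children_bus:
  assumes "y \<in> V" "dst x0 y = n"
  shows "card {z \<in> children x0 y. bus z = h} =
    (if bus y = int n
     then ((if n = 0 then r - 1 else r - 2) * (k - 1)) * of_bool (h = int n - 1)
       + of_bool (h = int n + 1) + (k - 2) * of_bool (h = int n)
     else (r - 1) * (k - 1) * of_bool (h = bus y - 1))"
proof -
  let ?t = "\<omega> (n + 2)"
  have bus_y: "bus y = int n + 2 - int (dst ?t y)"
    using bus_eq_Suc[OF assms] .
  have bz: "bus z = int n + 2 - int (dst ?t z)" if "z \<in> children x0 y" for z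
    using bus_eq[of z] children_pdist[OF x0 assms(1) that] assms(2) by simp
  have neq: "y \<noteq> ?t"
  proof
    assume "y = ?t"
    then have "dst x0 y = n + 2" by simp
    then show False using assms(2) by simp
  qed
  have y0: "x0 = y \<longleftrightarrow> n = 0"
    using pdist_eq_0_iff[OF x0 assms(1)] assms(2) by simp
  show ?thesis
  proof (cases "h \<le> int n + 2")
    case True
    \<comment> \<open>\<open>j\<close> is the distance from \<open>?t\<close> of a child on the
      horocycle \<open>h\<close>; for larger \<open>h\<close> it would be negative, and the count is
      zero.\<close>
    define j where "j = nat (int n + 2 - h)"
    have j: "int j = int n + 2 - h" using True by (simp add: j_def)
    have eq: "{z \<in> children x0 y. bus z = h} = {z \<in> children x0 y. dst ?t z = j}"
      using bz j by auto
    \<comment> \<open>As \<open>?t\<close> has distance \<open>n + 2\<close> from the origin, the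
      maximal value \<open>bus y = n\<close> means that \<open>y\<close> lies between the origin and
      \<open>?t\<close>.\<close>
    have c: "bus y = int n \<longleftrightarrow> dst x0 ?t = dst x0 y + dst ?t y"
      using bus_y assms(2) by auto
    have iffs: "h = bus y - 1 \<longleftrightarrow> j = Suc (dst ?t y)" using bus_y j by auto
    show ?thesis
    proof (cases "bus y = int n")
      case True
      then have "h = int n - 1 \<longleftrightarrow> j = Suc (dst ?t y)" "h = int n + 1 \<longleftrightarrow> Suc j = dst ?t y"
          "h = int n \<longleftrightarrow> j = dst ?t y"
        using bus_y j by auto
      then show ?thesis
        unfolding eq card_children_level[OF x0 ray_in assms(1) neq] c[symmetric] y0
        using True by simp
    next
      case False
      then show ?thesis
        unfolding eq card_children_level[OF x0 ray_in assms(1) neq] c[symmetric] y0 iffs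
        by simp
    qed
  next
    case False
    then have "{z \<in> children x0 y. bus z = h} = {}"
      using bz by auto
    then have "card {z \<in> children x0 y. bus z = h} = 0"
      by (simp only: card.empty)
    then show ?thesis
      using False bus_y by auto
  qed
qed

text \<open>\<open>card_children_bus\<close> is summed over the sphere of radius \<open>n\<close>.
  Vertices with \<open>bus y = n\<close> are taken separately, since only their children may lie on
  different horocycles.\<close>

lemma horo_count_Suc:
  "horo_count (Suc n) h =
    (r - 1) * (k - 1) * (if h + 1 = int n then 0 else horo_count n (h + 1))
    + horo_count n (int n) * (((if n = 0 then r - 1 else r - 2) * (k - 1)) * of_bool (h = int n - 1)
       + of_bool (h = int n + 1) + (k - 2) * of_bool (h = int n))"
proof -
  let ?L = "{y \<in> V. dst x0 y = n}"
  let ?c = "((if n = 0 then r - 1 else r - 2) * (k - 1)) * of_bool (h = int n - 1)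
       + of_bool (h = int n + 1) + (k - 2) * of_bool (h = int n)"
  let ?Q = "(r - 1) * (k - 1)"
  have fin: "finite ?L" using finite_sphere[OF x0] .
  have "{z \<in> V. dst x0 z = Suc n \<and> bus z = h} = (\<Union>y\<in>?L. {z \<in> children x0 y. bus z = h})"
    using sphere_Suc[OF x0, of n] by auto
  then have "horo_count (Suc n) h = (\<Sum>y\<in>?L. card {z \<in> children x0 y. bus z = h})"
    unfolding horo_count_def
  proof (simp only:, intro card_UN_disjoint ballI impI)
    show "finite {z \<in> children x0 y. bus z = h}" if "y \<in> ?L" for y
      using that finite_children by simp
    show "{z \<in> children x0 y. bus z = h} \<inter> {z \<in> children x0 y'. bus z = h} = {}"
      if "y \<in> ?L" "y' \<in> ?L" "y \<noteq> y'" for y y'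
      using that children_disjoint[OF x0, of y y'] by auto
  qed (rule fin)
  also have "\<dots> = (\<Sum>y\<in>?L. ?Q * of_bool (bus y = h + 1 \<and> bus y \<noteq> int n) + ?c * of_bool (bus y = int n))"
    by (intro sum.cong refl) (auto simp: card_children_bus)
  also have "\<dots> = ?Q * (\<Sum>y\<in>?L. of_bool (bus y = h + 1 \<and> bus y \<noteq> int n))
      + ?c * (\<Sum>y\<in>?L. of_bool (bus y = int n))"
    by (simp only: sum.distrib sum_distrib_left)
  also have "(\<Sum>y\<in>?L. of_bool (bus y = int n)) = horo_count n (int n)"
    using fin by (simp add: horo_count_def sum_of_bool_eq Int_def)
  also have "(\<Sum>y\<in>?L. of_bool (bus y = h + 1 \<and> bus y \<noteq> int n)) =
      (if h + 1 = int n then 0 else horo_count n (h + 1))"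
  proof (cases "h + 1 = int n")
    case False
    then have "(\<Sum>y\<in>?L. of_bool (bus y = h + 1 \<and> bus y \<noteq> int n)) = (\<Sum>y\<in>?L. of_bool (bus y = h + 1) :: nat)"
      by (intro sum.cong) auto
    then show ?thesis
      using fin False by (simp add: horo_count_def sum_of_bool_eq Int_def)
  qed (auto intro: sum.neutral)
  finally show ?thesis by (simp only: mult.commute)
qed

lemma horo_count_top: "horo_count n (int n) = 1"
  and horo_count_above: "int n < h \<Longrightarrow> horo_count n h = 0"
proof -
  have "horo_count n (int n) = 1 \<and> (\<forall>h. int n < h \<longrightarrow> horo_count n h = 0)"
  proof (induction n)
    case (Suc n)
    then show ?case by (simp add: horo_count_Suc)
  qed (simp add: horo_count_0)
  then show "horo_count n (int n) = 1" "int n < h \<Longrightarrow> horo_count n h = 0"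
    by auto
qed

lemma horo_count_below: "h < - int n \<Longrightarrow> horo_count n h = 0"
proof (induction n arbitrary: h)
  case (Suc n)
  then show ?case by (simp add: horo_count_Suc)
qed (simp add: horo_count_0)

definition q :: int where "q = (int r - 1) * (int k - 1)"

text \<open>The term with \<open>q\<close> treats the one vertex with \<open>bus y = n\<close> as if
  \<open>r - 1\<close> polygons led from it away from the ray. For \<open>n \<noteq> 0\<close> there
  are only \<open>r - 2\<close>, whence the correction by \<open>k - 1\<close>; at the origin
  \<open>r - 1\<close> is right.\<close>

lemma horo_count_rec:
  "int (horo_count (Suc n) h) = q * int (horo_count n (h + 1))
    + of_bool (h = int n + 1) + (int k - 2) * of_bool (h = int n)
    - (int k - 1) * of_bool (h = int n - 1 \<and> n \<noteq> 0)"
proof -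
  have "int (k - 1) = int k - 1" "int (k - 2) = int k - 2" "int (r - 1) = int r - 1"
      "int (r - 2) = int r - 2"
    using k2 r2 by (simp_all add: of_nat_diff)
  then show ?thesis
    by (simp add: horo_count_Suc horo_count_top q_def; auto simp: algebra_simps)
qed

text \<open>In the induction step the terms with the factor \<open>q\<close> cancel, because
  \<open>0 \<le> h\<close> rules out the exceptional case \<open>n = 0\<close> of
  \<open>horo_count_rec\<close>. What remains are the coefficients of
  \<open>(1 - S)(1 + (k - 1) S)\<close>.\<close>

lemma horo_count_diff:
  "0 \<le> h \<Longrightarrow> int (horo_count n h) - q * int (horo_count n (h + 2)) =
    of_bool (int n = h) + (int k - 2) * of_bool (int n = h + 1) - (int k - 1) * of_bool (int n = h + 2)"
proof (induction n arbitrary: h)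
  case 0
  then show ?case by (auto simp: horo_count_0)
next
  case (Suc n)
  have "int (horo_count (Suc n) h) - q * int (horo_count (Suc n) (h + 2)) =
    q * (int (horo_count n (h + 1)) - q * int (horo_count n (h + 1 + 2)))
    + (of_bool (h = int n + 1) + (int k - 2) * of_bool (h = int n)
    - (int k - 1) * of_bool (h = int n - 1 \<and> n \<noteq> 0))
    - q * (of_bool (h + 2 = int n + 1) + (int k - 2) * of_bool (h + 2 = int n)
    - (int k - 1) * of_bool (h + 2 = int n - 1 \<and> n \<noteq> 0))"
    by (simp add: horo_count_rec algebra_simps)
  also have "int (horo_count n (h + 1)) - q * int (horo_count n (h + 1 + 2)) =
      of_bool (int n = h + 1) + (int k - 2) * of_bool (int n = h + 1 + 1)
      - (int k - 1) * of_bool (int n = h + 1 + 2)"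
    using Suc.prems by (intro Suc.IH) simp
  finally show ?case
    using Suc.prems by (auto simp: of_bool_def algebra_simps split: if_splits)
qed

text \<open>\<open>horo_count_rec\<close> at \<open>- h\<close> and the induction hypothesis lead to
  \<open>q ^ h\<close> times the count at \<open>h - 1\<close>. Expanded by
  \<open>horo_count_diff\<close>, that count is the recursion for radius \<open>Suc n\<close> at
  \<open>h\<close>.\<close>

lemma horo_count_neg: "int (horo_count n (- int h)) = q ^ h * int (horo_count n (int h))"
proof (induction n arbitrary: h)
  case 0
  then show ?case by (cases h) (simp_all add: horo_count_0)
next
  case (Suc n)
  show ?case
  proof (cases h)
    case 0
    then show ?thesis by simp
  next
    case (Suc l)
    \<comment> \<open>No correction survives at a negative argument; for \<open>n = 0\<close> and
      \<open>h = 1\<close> this is due to the condition \<open>n \<noteq> 0\<close> in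
      \<open>horo_count_rec\<close>.\<close>
    have "int (horo_count (Suc n) (- int h)) = q * int (horo_count n (- int l))
       + (int k - 2) * 0 - (int k - 1) * 0"
      by (subst horo_count_rec) (auto simp: Suc)
    also have "\<dots> = q ^ h * int (horo_count n (int l))"
      using Suc.IH by (simp add: Suc)
    also have "int (horo_count n (int l)) = q * int (horo_count n (int l + 2))
       + of_bool (int n = int l) + (int k - 2) * of_bool (int n = int l + 1)
       - (int k - 1) * of_bool (int n = int l + 2)"
      using horo_count_diff[of "int l" n] by simp
    also have "\<dots> = int (horo_count (Suc n) (int h))"
      by (subst horo_count_rec) (auto simp: Suc add.commute)
    finally show ?thesis .
  qed
qed

end

section \<open>Inversion of the Abel transform\<close>

lemma infsum_finite_support_nat:
  fixes F :: "nat \<Rightarrow> complex"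
  assumes "\<And>m. K \<le> m \<Longrightarrow> F m = 0"
  shows "infsum F UNIV = sum F {..<K}"
proof -
  have "infsum F UNIV = infsum F {..<K}"
    by (rule infsum_cong_neutral) (use assms in auto)
  then show ?thesis by simp
qed

lemma infsum_atLeast_shift:
  fixes F :: "nat \<Rightarrow> complex"
  shows "infsum F {a..} = (\<Sum>\<^sub>\<infinity>m. F (m + a))"
proof -
  have "{a..} = range (\<lambda>m. m + a)"
    by (auto simp: image_iff intro: le_add_diff_inverse2[symmetric])
  then show ?thesis
    using infsum_reindex[of "\<lambda>m. m + a" UNIV F] by (simp add: o_def)
qed

text \<open>This is \<open>(1 - z S)^-1 F\<close>, the geometric series in the shift
  \<open>S\<close>, a finite sum for finitely supported \<open>F\<close>.\<close>

definition tail_sum :: "complex \<Rightarrow> (nat \<Rightarrow> complex) \<Rightarrow> nat \<Rightarrow> complex" where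
  "tail_sum z F n = (\<Sum>\<^sub>\<infinity>m. z ^ m * F (n + m))"

lemma tail_sum_eq_0:
  assumes "\<And>m. K \<le> m \<Longrightarrow> F m = 0" "K \<le> n"
  shows "tail_sum z F n = 0"
  unfolding tail_sum_def using assms by (intro infsum_0) auto

lemma tail_sum_step:
  assumes "\<And>m. K \<le> m \<Longrightarrow> F m = 0"
  shows "tail_sum z F n = F n + z * tail_sum z F (Suc n)"
proof -
  \<comment> \<open>One term more than for \<open>Suc n\<close>, so that the ranges match once
    \<open>m = 0\<close> is split off.\<close>
  have "tail_sum z F n = (\<Sum>m<Suc K. z ^ m * F (n + m))"
    unfolding tail_sum_def by (rule infsum_finite_support_nat) (use assms in auto)
  moreover have "tail_sum z F (Suc n) = (\<Sum>m<K. z ^ m * F (Suc n + m))"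
    unfolding tail_sum_def by (rule infsum_finite_support_nat) (use assms in auto)
  ultimately show ?thesis
    by (simp only: sum.lessThan_Suc_shift) (simp add: sum_distrib_left mult_ac)
qed

text \<open>Descending induction from the bound \<open>K\<close>. This uniqueness principle serves
  to compare \<open>f\<close> with the inversion formula, \<open>Ab f\<close> with \<open>g\<close>,
  and the two forms of the inverse.\<close>

lemma finite_support_rec_eq_0:
  fixes u :: "nat \<Rightarrow> complex"
  assumes "\<And>n. K \<le> n \<Longrightarrow> u n = 0" and "\<And>n. u n + a * u (n + 1) - b * u (n + 2) = 0"
  shows "u n = 0"
proof (induction "K - n" arbitrary: n rule: less_induct)
  case less
  show ?case
  proof (cases "K \<le> n")
    case False
    then have "u (n + 1) = 0" "u (n + 2) = 0"
      by (intro less; simp)+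
    then show ?thesis using assms(2)[of n] by simp
  qed (use assms(1) in simp)
qed

context polygon_graph_ray
begin

section \<open>Radial functions and their Abel transform\<close>

definition Q :: real where "Q = (real r - 1) * (real k - 1)"

lemma Q_pos: "0 < Q"
  using k2 r2 by (simp add: Q_def)

lemma Q_powr_shift: "Q powr (- real (n + 2) / 2) * Q = Q powr (- real n / 2)"
proof -
  have "Q powr (- real (n + 2) / 2) * Q powr 1 = Q powr (- real n / 2)"
    by (simp only: powr_add[symmetric]) (simp add: field_simps)
  then show ?thesis using Q_pos by simp
qed

lemma q_eq_Q: "of_int q = complex_of_real Q"
  by (simp add: q_def Q_def)

lemma pdist_commute_x0 [simp]: "x \<in> V \<Longrightarrow> dst x x0 = dst x0 x"
  using pdist_sym x0 by blast

lemma radial_bound: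
  assumes "f \<in> radial_funs k V E x0" obtains K where "\<And>n. K \<le> n \<Longrightarrow> f (\<omega> n) = 0"
proof -
  have "inj \<omega>"
    by (rule injI) (use pdist_origin_ray in metis)
  then have "finite (\<omega> -` {x. f x \<noteq> 0})"
    using assms by (intro finite_vimageI) (auto simp: radial_funs_def fin_supp_funs_def)
  then obtain K where K: "\<forall>n\<in>\<omega> -` {x. f x \<noteq> 0}. n < K"
    by (auto simp: finite_nat_set_iff_bounded)
  then have "f (\<omega> n) = 0" if "K \<le> n" for n
    using that by (cases "f (\<omega> n) = 0") auto
  then show ?thesis by (rule that)
qed

text \<open>The node \<open>\<omega> n\<close> represents the sphere of radius \<open>n\<close>, so
  a radial function is determined by its values along the ray.\<close>

lemma radial_eq:
  assumes "f \<in> radial_funs k V E x0" "x \<in> V"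
  shows "f x = f (\<omega> (dst x0 x))"
proof -
  have "dst x x0 = dst (\<omega> (dst x0 x)) x0" using assms(2) by simp
  moreover have "\<forall>x\<in>V. \<forall>y\<in>V. dst x x0 = dst y x0 \<longrightarrow> f x = f y"
    using assms(1) unfolding radial_funs_def by blast
  ultimately show ?thesis
    using assms(2) ray_in by blast
qed

lemma radial_outside: "f \<in> radial_funs k V E x0 \<Longrightarrow> x \<notin> V \<Longrightarrow> f x = 0"
  by (auto simp: radial_funs_def fin_supp_funs_def)

lemma radialI:
  assumes "\<And>n. K \<le> n \<Longrightarrow> \<phi> n = 0" "\<And>x. x \<in> V \<Longrightarrow> f x = \<phi> (dst x0 x)" "\<And>x. x \<notin> V \<Longrightarrow> f x = 0"
  shows "f \<in> radial_funs k V E x0"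
proof -
  have "{x. f x \<noteq> 0} \<subseteq> (\<Union>n<K. {x \<in> V. dst x0 x = n})"
  proof
    fix x assume x: "x \<in> {x. f x \<noteq> 0}"
    then have "x \<in> V" using assms(3) by auto
    moreover have "dst x0 x < K"
      using x assms(1)[of "dst x0 x"] assms(2)[OF \<open>x \<in> V\<close>] by (cases "K \<le> dst x0 x") auto
    ultimately show "x \<in> (\<Union>n<K. {x \<in> V. dst x0 x = n})" by blast
  qed
  moreover have "finite (\<Union>n<K. {x \<in> V. dst x0 x = n})"
    using finite_sphere[OF x0] by blast
  ultimately have "finite {x. f x \<noteq> 0}"
    by (rule finite_subset)
  moreover have "{x. f x \<noteq> 0} \<subseteq> V" using assms(3) by auto
  moreover have "f x = f y" if "x \<in> V" "y \<in> V" "dst x x0 = dst y x0" for x y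
    using assms(2) that by simp
  ultimately show ?thesis
    unfolding radial_funs_def fin_supp_funs_def by blast
qed

lemma radial_value_eq:
  assumes "f \<in> radial_funs k V E x0"
  shows "radial_value k V E x0 f n = f (\<omega> n)"
  unfolding radial_value_def
proof (rule the_equality)
  show "\<forall>x\<in>V. dst x x0 = n \<longrightarrow> f x = f (\<omega> n)"
  proof (intro ballI impI)
    fix x assume "x \<in> V" "dst x x0 = n"
    then show "f x = f (\<omega> n)" using radial_eq[OF assms, of x] by simp
  qed
  show "c = f (\<omega> n)" if "\<forall>x\<in>V. dst x x0 = n \<longrightarrow> f x = c" for c
    using that[rule_format, of "\<omega> n"] by simp
qed

abbreviation Ab :: "('v \<Rightarrow> complex) \<Rightarrow> int \<Rightarrow> complex" where
  "Ab \<equiv> abel k r V E x0 \<omega>"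

text \<open>The horocycle is cut into its intersections with the spheres; radii from
  \<open>K\<close> on contribute zero.\<close>

lemma abel_eq_sum:
  assumes "f \<in> radial_funs k V E x0" "\<And>n. K \<le> n \<Longrightarrow> f (\<omega> n) = 0"
  shows "Ab f h = complex_of_real (Q powr (of_int h / 2)) *
    (\<Sum>n<K. of_nat (horo_count n h) * f (\<omega> n))"
proof -
  note radial = radial_eq[OF assms(1)]
  let ?S = "\<lambda>n. {x \<in> V. dst x0 x = n \<and> bus x = h}"
  have fin: "finite (?S n)" for n
    using finite_sphere[OF x0, of n] by (rule rev_finite_subset) auto
  have "infsum f (horocycle k V E x0 \<omega> h) = infsum f (\<Union>n<K. ?S n)"
  proof (rule infsum_cong_neutral)
    fix x assume "x \<in> horocycle k V E x0 \<omega> h - (\<Union>n<K. ?S n)"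
    then have "x \<in> V" "K \<le> dst x0 x"
      by (auto simp: horocycle_def)
    then show "f x = 0"
      using assms(2) radial[of x] by simp
  qed (auto simp: horocycle_def)
  also have "\<dots> = sum f (\<Union>n<K. ?S n)"
    using fin by (intro infsum_finite) blast
  also have "\<dots> = (\<Sum>n<K. sum f (?S n))"
    using fin by (intro sum.UNION_disjoint) auto
  also have "\<dots> = (\<Sum>n<K. of_nat (horo_count n h) * f (\<omega> n))"
  proof (rule sum.cong)
    fix n
    have "sum f (?S n) = (\<Sum>x\<in>?S n. f (\<omega> n))"
    proof (rule sum.cong)
      fix x assume "x \<in> ?S n"
      then show "f x = f (\<omega> n)" using radial[of x] by simp
    qed simp
    then show "sum f (?S n) = of_nat (horo_count n h) * f (\<omega> n)"
      by (simp add: horo_count_def)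
  qed simp
  finally show ?thesis
    by (simp add: abel_def Q_def)
qed

lemma abel_linear:
  assumes f1: "f1 \<in> radial_funs k V E x0" and f2: "f2 \<in> radial_funs k V E x0"
  shows "Ab (\<lambda>x. a * f1 x + b * f2 x) = (\<lambda>h. a * Ab f1 h + b * Ab f2 h)"
proof
  fix h
  obtain K1 where K1: "\<And>n. K1 \<le> n \<Longrightarrow> f1 (\<omega> n) = 0"
    by (rule radial_bound[OF f1]) blast
  obtain K2 where K2: "\<And>n. K2 \<le> n \<Longrightarrow> f2 (\<omega> n) = 0"
    by (rule radial_bound[OF f2]) blast
  let ?K = "max K1 K2" and ?f = "\<lambda>x. a * f1 x + b * f2 x"
  have K: "?f (\<omega> n) = 0" if "?K \<le> n" for n
    using K1[of n] K2[of n] that by simp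
  have f: "?f \<in> radial_funs k V E x0"
  proof (rule radialI[of ?K "\<lambda>n. ?f (\<omega> n)"])
    show "?f x = ?f (\<omega> (dst x0 x))" if "x \<in> V" for x
      using radial_eq[OF f1 that] radial_eq[OF f2 that] by simp
    show "?f x = 0" if "x \<notin> V" for x
      using radial_outside[OF f1 that] radial_outside[OF f2 that] by simp
  qed (rule K)
  have "Ab f1 h = complex_of_real (Q powr (of_int h / 2)) *
      (\<Sum>n<?K. of_nat (horo_count n h) * f1 (\<omega> n))"
    "Ab f2 h = complex_of_real (Q powr (of_int h / 2)) *
      (\<Sum>n<?K. of_nat (horo_count n h) * f2 (\<omega> n))"
    using abel_eq_sum[OF f1, of ?K] abel_eq_sum[OF f2, of ?K] K1 K2 by auto
  moreover have "Ab ?f h = complex_of_real (Q powr (of_int h / 2)) *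
      (\<Sum>n<?K. of_nat (horo_count n h) * ?f (\<omega> n))"
    by (rule abel_eq_sum[OF f K])
  ultimately show "Ab ?f h = a * Ab f1 h + b * Ab f2 h"
    by (simp add: algebra_simps sum.distrib sum_distrib_left)
qed

text \<open>The weights turn the left side into a sum with coefficients
  \<open>N(j,n) - Q N(j,n+2)\<close>, which \<open>horo_count_diff\<close> reduces to three terms.
  This is \<open>(1 - S)(1 + (k - 1) S) f = (1 - Q S^2) F\<close> for
  \<open>g = A f\<close>.\<close>

lemma abel_rec:
  assumes "f \<in> radial_funs k V E x0"
  shows "of_real (Q powr (- real n / 2)) * (Ab f (int n) - Ab f (int n + 2)) =
    f (\<omega> n) + (of_nat k - 2) * f (\<omega> (n + 1)) - (of_nat k - 1) * f (\<omega> (n + 2))"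
proof -
  obtain K0 where K0: "\<And>n. K0 \<le> n \<Longrightarrow> f (\<omega> n) = 0"
    by (rule radial_bound[OF assms]) blast
  \<comment> \<open>The bound is enlarged so that \<open>n\<close>, \<open>n + 1\<close> and
    \<open>n + 2\<close> all occur as summation indices.\<close>
  define K where "K = max K0 (n + 3)"
  have K: "f (\<omega> n) = 0" if "K \<le> n" for n
    using that K0 by (simp add: K_def)
  let ?N = "\<lambda>h. \<Sum>j<K. of_nat (horo_count j h) * f (\<omega> j)"
  let ?p = "complex_of_real (Q powr (- real n / 2))"
  have eq: "?p * Ab f h = complex_of_real (Q powr (- real n / 2) * Q powr (of_int h / 2)) * ?N h" for h
    using abel_eq_sum[OF assms K, where h = h] by simp
  have "Q powr (- real n / 2) * Q powr (real_of_int (int n) / 2) = 1"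
    using Q_pos by (simp add: powr_add[symmetric])
  moreover have "Q powr (- real n / 2) * Q powr (real_of_int (int n + 2) / 2) = Q"
    using Q_pos by (simp add: powr_add[symmetric] add_divide_distrib)
  ultimately have "?p * (Ab f (int n) - Ab f (int n + 2)) = ?N (int n) - of_real Q * ?N (int n + 2)"
    by (simp only: right_diff_distrib eq of_real_1 mult_1)
  also have "\<dots> = (\<Sum>j<K. of_int (int (horo_count j (int n)) - q * int (horo_count j (int n + 2))) * f (\<omega> j))"
    by (simp add: sum_distrib_left sum_subtractf[symmetric] q_eq_Q algebra_simps)
  also have "\<dots> = (\<Sum>j<K. (if j = n then f (\<omega> j) else 0) + (if j = n + 1 then (of_nat k - 2) * f (\<omega> j) else 0)
      - (if j = n + 2 then (of_nat k - 1) * f (\<omega> j) else 0))"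
    by (intro sum.cong refl) (simp only: horo_count_diff, auto simp: algebra_simps)
  also have "\<dots> = f (\<omega> n) + (of_nat k - 2) * f (\<omega> (n + 1)) - (of_nat k - 1) * f (\<omega> (n + 2))"
  proof -
    have "n < K" "n + 1 < K" "n + 2 < K" by (simp_all add: K_def)
    then show ?thesis by (simp add: sum.distrib sum_subtractf)
  qed
  finally show ?thesis .
qed

text \<open>The counts vanish for \<open>\<bar>h\<bar> > n\<close>, which bounds the support.
  Evenness comes from \<open>horo_count_neg\<close>, whose factor \<open>Q ^ l\<close> turns the
  weight at \<open>- l\<close> into the weight at \<open>l\<close>.\<close>

lemma abel_even_funs:
  assumes "f \<in> radial_funs k V E x0"
  shows "Ab f \<in> even_funs"
proof -
  obtain K where K: "\<And>n. K \<le> n \<Longrightarrow> f (\<omega> n) = 0"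
    by (rule radial_bound[OF assms]) blast
  have eq: "Ab f h = complex_of_real (Q powr (of_int h / 2)) *
    (\<Sum>n<K. of_nat (horo_count n h) * f (\<omega> n))" for h
    by (rule abel_eq_sum[OF assms K])
  have "Ab f h = 0" if "h \<notin> {- int K..int K}" for h
  proof -
    have "horo_count n h = 0" if "n < K" for n
      using horo_count_above[of n h] horo_count_below[of h n] \<open>h \<notin> _\<close> that by force
    then show ?thesis unfolding eq by simp
  qed
  then have "{h. Ab f h \<noteq> 0} \<subseteq> {- int K..int K}" by blast
  then have "finite {h. Ab f h \<noteq> 0}"
    by (rule finite_subset) simp
  moreover have nat: "Ab f (- int l) = Ab f (int l)" for l
  proof -
    have "Q powr (- real l / 2) * Q ^ l = Q powr (real l / 2)"
      using Q_pos by (simp add: powr_realpow[symmetric] powr_add[symmetric])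
    then have Q: "complex_of_real (Q powr (- real l / 2)) * of_real Q ^ l = of_real (Q powr (real l / 2))"
      by (metis of_real_mult of_real_power)
    have "of_nat (horo_count n (- int l)) = (of_real Q ^ l * of_nat (horo_count n (int l)) :: complex)" for n
      using arg_cong[OF horo_count_neg[of n l], of "of_int :: int \<Rightarrow> complex"] by (simp add: q_eq_Q)
    then have "Ab f (- int l) = of_real (Q powr (- real l / 2)) * of_real Q ^ l *
        (\<Sum>n<K. of_nat (horo_count n (int l)) * f (\<omega> n))"
      unfolding eq by (simp add: sum_distrib_left mult_ac)
    then show ?thesis
      unfolding Q eq by simp
  qed
  moreover have "Ab f (- h) = Ab f h" for h
    using nat[of "nat h"] nat[of "nat (- h)"] by (cases "0 \<le> h") auto
  ultimately show ?thesis
    by (auto simp: even_funs_def fin_supp_funs_def)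
qed

text \<open>Partial fractions: \<open>1/((1 - S)(1 + (k-1) S))\<close> equals \<open>1/k\<close>
  times \<open>1/(1 - S) + (k-1)/(1 + (k-1) S)\<close>. It is applied to
  \<open>(1 - Q S^2) F\<close>, whose value at \<open>j\<close> is the weighted difference of
  \<open>g\<close> in the body.\<close>

definition inv_abel :: "(int \<Rightarrow> complex) \<Rightarrow> nat \<Rightarrow> complex" where
  "inv_abel g n = 1 / of_nat k *
    (tail_sum 1 (\<lambda>j. of_real (Q powr (- real j / 2)) * (g (int j) - g (int j + 2))) n
    + (of_nat k - 1) *
      tail_sum (- (of_nat k - 1)) (\<lambda>j. of_real (Q powr (- real j / 2)) * (g (int j) - g (int j + 2))) n)"

lemma even_funs_bound:
  assumes "g \<in> even_funs" obtains K where "\<And>n. K \<le> n \<Longrightarrow> g (int n) = 0"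
proof -
  have "finite (int -` {h. g h \<noteq> 0})"
    using assms by (intro finite_vimageI) (auto simp: even_funs_def fin_supp_funs_def)
  then obtain K where K: "\<forall>n\<in>int -` {h. g h \<noteq> 0}. n < K"
    by (auto simp: finite_nat_set_iff_bounded)
  then have "g (int n) = 0" if "K \<le> n" for n
    using that by (cases "g (int n) = 0") auto
  then show ?thesis by (rule that)
qed

lemma inv_abel_support:
  assumes "g \<in> even_funs" obtains K where "\<And>n. K \<le> n \<Longrightarrow> inv_abel g n = 0"
proof -
  obtain K where K: "\<And>n. K \<le> n \<Longrightarrow> g (int n) = 0"
    by (rule even_funs_bound[OF assms]) blast
  have G: "complex_of_real (Q powr (- real j / 2)) * (g (int j) - g (int j + 2)) = 0" if "K \<le> j" for j
    using K[of j] K[of "j + 2"] that by (simp add: add.commute)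
  have "inv_abel g n = 0" if "K \<le> n" for n
  proof -
    have "tail_sum z (\<lambda>j. of_real (Q powr (- real j / 2)) * (g (int j) - g (int j + 2))) n = 0" for z
      by (rule tail_sum_eq_0[OF G that])
    then show ?thesis unfolding inv_abel_def by (simp only: mult_zero_right add_0)
  qed
  then show ?thesis by (rule that)
qed

lemma inv_abel_rec:
  assumes "g \<in> even_funs"
  shows "inv_abel g n + (of_nat k - 2) * inv_abel g (n + 1) - (of_nat k - 1) * inv_abel g (n + 2) =
    of_real (Q powr (- real n / 2)) * (g (int n) - g (int n + 2))"
proof -
  obtain K where K: "\<And>n. K \<le> n \<Longrightarrow> g (int n) = 0"
    by (rule even_funs_bound[OF assms]) blast
  define G where "G = (\<lambda>j. complex_of_real (Q powr (- real j / 2)) * (g (int j) - g (int j + 2)))"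
  have "G j = 0" if "K \<le> j" for j
    using K[of j] K[of "j + 2"] that by (simp add: G_def add.commute)
  then have step: "tail_sum z G n = G n + z * tail_sum z G (Suc n)" for z n
    by (rule tail_sum_step)
  have inv: "inv_abel g n = 1 / of_nat k * (tail_sum 1 G n + (of_nat k - 1) * tail_sum (- (of_nat k - 1)) G n)" for n
    unfolding inv_abel_def G_def ..
  \<comment> \<open>Here \<open>z\<close> is \<open>k\<close>, \<open>a\<close> and \<open>b\<close>
    are \<open>G n\<close> and \<open>G (n + 1)\<close>, and \<open>t\<close> and \<open>s\<close>
    are the two tail sums at \<open>n + 2\<close>.\<close>
  have alg: "1 / z * ((a + (b + t)) + (z - 1) * (a + - (z - 1) * (b + - (z - 1) * s)))
      + (z - 2) * (1 / z * ((b + t) + (z - 1) * (b + - (z - 1) * s)))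
      - (z - 1) * (1 / z * (t + (z - 1) * s)) = a" if "z \<noteq> 0" for z a b s t :: complex
    using that by (simp add: field_simps)
  have steps: "tail_sum z G n = G n + z * (G (n + 1) + z * tail_sum z G (n + 2))"
      "tail_sum z G (n + 1) = G (n + 1) + z * tail_sum z G (n + 2)" for z
    using step[of z n] step[of z "Suc n"] by simp_all
  have "inv_abel g n + (of_nat k - 2) * inv_abel g (n + 1) - (of_nat k - 1) * inv_abel g (n + 2) = G n"
    unfolding inv steps mult_1 using k2 by (intro alg) simp
  then show ?thesis by (simp add: G_def)
qed

text \<open>By \<open>abel_rec\<close> and \<open>inv_abel_rec\<close> both sides satisfy the same
  recursion, and both have finite support.\<close>

lemma abel_inverse:
  assumes "f \<in> radial_funs k V E x0"
  shows "f (\<omega> n) = inv_abel (Ab f) n"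
proof -
  obtain K where K: "\<And>n. K \<le> n \<Longrightarrow> f (\<omega> n) = 0"
    by (rule radial_bound[OF assms]) blast
  note g = abel_even_funs[OF assms]
  obtain K' where K': "\<And>n. K' \<le> n \<Longrightarrow> inv_abel (Ab f) n = 0"
    by (rule inv_abel_support[OF g]) blast
  have "f (\<omega> n) - inv_abel (Ab f) n = 0"
  proof (rule finite_support_rec_eq_0[of "max K K'" _ "of_nat k - 2" "of_nat k - 1"])
    show "f (\<omega> n) - inv_abel (Ab f) n = 0" if "max K K' \<le> n" for n
      using K K' that by simp
    show "f (\<omega> n) - inv_abel (Ab f) n + (of_nat k - 2) * (f (\<omega> (n + 1)) - inv_abel (Ab f) (n + 1))
        - (of_nat k - 1) * (f (\<omega> (n + 2)) - inv_abel (Ab f) (n + 2)) = 0" for n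
    proof -
      have "f (\<omega> n) - inv_abel (Ab f) n + (of_nat k - 2) * (f (\<omega> (n + 1)) - inv_abel (Ab f) (n + 1))
          - (of_nat k - 1) * (f (\<omega> (n + 2)) - inv_abel (Ab f) (n + 2)) =
        (f (\<omega> n) + (of_nat k - 2) * f (\<omega> (n + 1)) - (of_nat k - 1) * f (\<omega> (n + 2)))
        - (inv_abel (Ab f) n + (of_nat k - 2) * inv_abel (Ab f) (n + 1)
          - (of_nat k - 1) * inv_abel (Ab f) (n + 2))"
        by (simp add: algebra_simps)
      then show ?thesis
        unfolding abel_rec[OF assms, symmetric] inv_abel_rec[OF g] by simp
    qed
  qed
  then show ?thesis by simp
qed

lemma abel_surj:
  assumes g: "g \<in> even_funs"
  obtains f where "f \<in> radial_funs k V E x0" "Ab f = g"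
proof
  define f where "f x = (if x \<in> V then inv_abel g (dst x0 x) else 0)" for x
  have f\<omega>: "f (\<omega> n) = inv_abel g n" for n
    by (simp add: f_def)
  obtain K where K: "\<And>n. K \<le> n \<Longrightarrow> inv_abel g n = 0"
    by (rule inv_abel_support[OF g]) blast
  show rf: "f \<in> radial_funs k V E x0"
    by (rule radialI[OF K]) (auto simp: f_def)
  note Af = abel_even_funs[OF rf]
  obtain K1 where K1: "\<And>n. K1 \<le> n \<Longrightarrow> g (int n) = 0"
    by (rule even_funs_bound[OF g]) blast
  obtain K2 where K2: "\<And>n. K2 \<le> n \<Longrightarrow> Ab f (int n) = 0"
    by (rule even_funs_bound[OF Af]) blast
  \<comment> \<open>The recursions for \<open>f\<close> and \<open>inv_abel g\<close> give
    \<open>Ab f\<close> and \<open>g\<close> equal differences between \<open>n\<close> and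
    \<open>n + 2\<close>, hence the coefficients \<open>0\<close> and \<open>1\<close>. Evenness
    then extends the equality to negative arguments.\<close>
  have "Ab f (int n) - g (int n) = 0" for n
  proof (rule finite_support_rec_eq_0[of "max K1 K2" _ 0 1])
    show "Ab f (int n) - g (int n) = 0" if "max K1 K2 \<le> n" for n
      using K1 K2 that by simp
    have "of_real (Q powr (- real n / 2)) * (Ab f (int n) - Ab f (int n + 2)) =
        of_real (Q powr (- real n / 2)) * (g (int n) - g (int n + 2))" for n
      using abel_rec[OF rf, of n] inv_abel_rec[OF g, of n] by (simp add: f\<omega>)
    then have "Ab f (int n) = g (int n) - g (int n + 2) + Ab f (int n + 2)" for n
      using Q_pos by (simp add: diff_eq_eq)
    then show "Ab f (int n) - g (int n) + 0 * (Ab f (int (n + 1)) - g (int (n + 1)))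
        - 1 * (Ab f (int (n + 2)) - g (int (n + 2))) = 0" for n
      by (simp add: add.commute)
  qed
  then have "Ab f (int n) = g (int n)" for n by simp
  moreover have "Ab f (- h) = Ab f h" "g (- h) = g h" for h
    using g Af by (auto simp: even_funs_def)
  ultimately show "Ab f = g"
    by (intro ext) (metis int_cases2)
qed

lemma abel_bij: "bij_betw Ab (radial_funs k V E x0) even_funs"
  unfolding bij_betw_def
proof
  show "inj_on Ab (radial_funs k V E x0)"
  proof (intro inj_onI ext)
    fix f f' x assume f: "f \<in> radial_funs k V E x0" "f' \<in> radial_funs k V E x0" "Ab f = Ab f'"
    have "f (\<omega> n) = f' (\<omega> n)" for n
      using abel_inverse[OF f(1)] abel_inverse[OF f(2)] f(3) by simp
    then show "f x = f' x"
      using radial_eq[OF f(1)] radial_eq[OF f(2)] radial_outside[OF f(1)] radial_outside[OF f(2)]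
      by (cases "x \<in> V") metis+
  qed
  show "Ab ` radial_funs k V E x0 = even_funs"
    using abel_even_funs abel_surj by blast
qed

section \<open>The two explicit formulas for the inverse\<close>

lemma powr_half_mult:
  "complex_of_real (Q powr (- real a / 2)) * of_real (Q powr (- real b / 2)) =
    of_real (Q powr (- real (a + b) / 2))"
  by (simp add: powr_add[symmetric] of_real_mult[symmetric] add_divide_distrib diff_divide_distrib
      del: of_real_mult)

text \<open>The summation index is shifted by one; the exponents \<open>(n - 1)/2\<close> and
  \<open>(m + 1)/2\<close> then add up to \<open>(n + m)/2\<close>. In the alternating sum the shift
  splits off a factor \<open>k - 1\<close>.\<close>

lemma inv_abel_eq1:
  "inv_abel g n = 1 / of_nat k * of_real (Q powr (- (real n - 1) / 2)) *
    ((\<Sum>\<^sub>\<infinity>m\<in>{1::nat..}. of_real (Q powr (- real m / 2)) *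
         (g (int n + int m - 1) - g (int n + int m + 1)))
   + (\<Sum>\<^sub>\<infinity>m\<in>{1::nat..}. (-1) ^ (m - 1) * (of_nat k - 1) ^ m *
         of_real (Q powr (- real m / 2)) *
         (g (int n + int m - 1) - g (int n + int m + 1))))"
proof -
  let ?p = "complex_of_real (Q powr (- (real n - 1) / 2))"
  have p: "?p * of_real (Q powr (- real (m + 1) / 2)) = of_real (Q powr (- real (n + m) / 2))" for m
    unfolding of_real_mult[symmetric] powr_add[symmetric]
    by (simp add: add_divide_distrib diff_divide_distrib)
  have "?p * (\<Sum>\<^sub>\<infinity>m\<in>{1::nat..}. of_real (Q powr (- real m / 2)) *
         (g (int n + int m - 1) - g (int n + int m + 1))) =
      tail_sum 1 (\<lambda>j. of_real (Q powr (- real j / 2)) * (g (int j) - g (int j + 2))) n"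
    unfolding infsum_atLeast_shift infsum_cmult_right'[symmetric] tail_sum_def mult.assoc[symmetric] p
    by (simp add: algebra_simps)
  moreover have "?p * (\<Sum>\<^sub>\<infinity>m\<in>{1::nat..}. (-1) ^ (m - 1) * (of_nat k - 1) ^ m *
         of_real (Q powr (- real m / 2)) * (g (int n + int m - 1) - g (int n + int m + 1))) =
      (of_nat k - 1) *
      tail_sum (- (of_nat k - 1)) (\<lambda>j. of_real (Q powr (- real j / 2)) * (g (int j) - g (int j + 2))) n"
    unfolding infsum_atLeast_shift infsum_cmult_right'[symmetric] tail_sum_def
  proof (rule infsum_cong)
    fix m :: nat
    have "?p * ((-1) ^ (m + 1 - 1) * (of_nat k - 1) ^ (m + 1) * of_real (Q powr (- real (m + 1) / 2)) *
          (g (int n + int (m + 1) - 1) - g (int n + int (m + 1) + 1))) =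
        (of_nat k - 1) * (((-1) ^ m * (of_nat k - 1) ^ m) *
          (?p * of_real (Q powr (- real (m + 1) / 2)) * (g (int (n + m)) - g (int (n + m) + 2))))"
      by (simp add: mult_ac add_ac)
    then show "?p * ((-1) ^ (m + 1 - 1) * (of_nat k - 1) ^ (m + 1) * of_real (Q powr (- real (m + 1) / 2)) *
          (g (int n + int (m + 1) - 1) - g (int n + int (m + 1) + 1))) =
        (of_nat k - 1) * ((- (of_nat k - 1)) ^ m *
          (of_real (Q powr (- real (n + m) / 2)) * (g (int (n + m)) - g (int (n + m) + 2))))"
      unfolding p by (simp only: power_minus[of "of_nat k - 1"] mult.assoc)
  qed
  ultimately show ?thesis
    unfolding inv_abel_def by (simp only: distrib_left mult.assoc)
qed

text \<open>This expands \<open>(1 - Q S^2)/((1 - S)(1 + (k-1) S))\<close> as \<open>1 - (k-2) S -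
  ((Q-1)/k) S^2/(1 - S) - ((r-k)/k) (k-1)^2 S^2/(1 + (k-1) S)\<close>. The proof checks that the
  right side satisfies the recursion of \<open>inv_abel g\<close> and appeals to uniqueness.\<close>

lemma inv_abel_eq2:
  assumes "g \<in> even_funs"
  shows "inv_abel g n = of_real (Q powr (- real n / 2)) *
    (g (int n)
   - (of_nat k - 2) * of_real (Q powr (- 1 / 2)) * g (int n + 1)
   - of_real ((Q - 1) / real k) *
       (\<Sum>\<^sub>\<infinity>m\<in>{2::nat..}. of_real (Q powr (- real m / 2)) * g (int n + int m))
   - of_real ((real r - real k) / real k) *
       (\<Sum>\<^sub>\<infinity>m\<in>{2::nat..}. (-1) ^ m * (of_nat k - 1) ^ m *
         of_real (Q powr (- real m / 2)) * g (int n + int m)))"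
    (is "_ = ?rhs n")
proof -
  define F where "F j = complex_of_real (Q powr (- real j / 2)) * g (int j)" for j
  obtain K where "\<And>n. K \<le> n \<Longrightarrow> g (int n) = 0"
    by (rule even_funs_bound[OF assms]) blast
  then have F0: "F j = 0" if "K \<le> j" for j
    using that by (simp add: F_def)
  have step: "tail_sum z F n = F n + z * tail_sum z F (Suc n)" for z n
    by (rule tail_sum_step[OF F0])
  let ?c = "of_nat k - 1 :: complex"
  \<comment> \<open>\<open>v\<close> is the right side with the powers of \<open>Q\<close> absorbed
    into \<open>F\<close> and the sums from \<open>m = 2\<close> written as tail sums at
    \<open>n + 2\<close>; the alternating one leaves the factor \<open>(k - 1)^2\<close>.\<close>
  define v where "v n = F n - (of_nat k - 2) * F (n + 1)
      - of_real ((Q - 1) / real k) * tail_sum 1 F (n + 2)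
      - of_real ((real r - real k) / real k) * (?c\<^sup>2 * tail_sum (- ?c) F (n + 2))" for n
  have v: "?rhs n = v n" for n
  proof -
    let ?p = "complex_of_real (Q powr (- real n / 2))"
    have 1: "?p * (of_real (Q powr (- 1 / 2)) * g (int n + 1)) = F (n + 1)"
      using powr_half_mult[of n 1] by (simp add: F_def mult.assoc[symmetric] add.commute)
    have p: "?p * (of_real (Q powr (- real (m + 2) / 2)) * g (int n + int (m + 2))) = F (n + 2 + m)" for m
      unfolding mult.assoc[symmetric] powr_half_mult F_def by (simp add: algebra_simps)
    have 2: "?p * (\<Sum>\<^sub>\<infinity>m\<in>{2::nat..}. of_real (Q powr (- real m / 2)) * g (int n + int m)) = tail_sum 1 F (n + 2)"
      unfolding infsum_atLeast_shift infsum_cmult_right'[symmetric] tail_sum_def p by simp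
    have 3: "?p * (\<Sum>\<^sub>\<infinity>m\<in>{2::nat..}. (-1) ^ m * (of_nat k - 1) ^ m *
         of_real (Q powr (- real m / 2)) * g (int n + int m)) = ?c\<^sup>2 * tail_sum (- ?c) F (n + 2)"
      unfolding infsum_atLeast_shift infsum_cmult_right'[symmetric] tail_sum_def
    proof (rule infsum_cong)
      fix m :: nat
      have "?p * ((-1) ^ (m + 2) * ?c ^ (m + 2) * of_real (Q powr (- real (m + 2) / 2)) * g (int n + int (m + 2)))
        = ?c\<^sup>2 * ((-1) ^ m * ?c ^ m * (?p * (of_real (Q powr (- real (m + 2) / 2)) * g (int n + int (m + 2)))))"
        by (simp add: power_add power2_eq_square mult_ac)
      then show "?p * ((-1) ^ (m + 2) * ?c ^ (m + 2) * of_real (Q powr (- real (m + 2) / 2)) * g (int n + int (m + 2)))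
        = ?c\<^sup>2 * ((- ?c) ^ m * F (n + 2 + m))"
        unfolding p by (simp only: power_minus[of ?c])
    qed
    have "?rhs n = ?p * g (int n) - (of_nat k - 2) * (?p * (of_real (Q powr (- 1 / 2)) * g (int n + 1)))
      - of_real ((Q - 1) / real k) *
       (?p * (\<Sum>\<^sub>\<infinity>m\<in>{2::nat..}. of_real (Q powr (- real m / 2)) * g (int n + int m)))
      - of_real ((real r - real k) / real k) *
       (?p * (\<Sum>\<^sub>\<infinity>m\<in>{2::nat..}. (-1) ^ m * (of_nat k - 1) ^ m *
         of_real (Q powr (- real m / 2)) * g (int n + int m)))"
      by (simp only: right_diff_distrib mult_ac)
    then show ?thesis
      unfolding 1 2 3 v_def F_def .
  qed
  have v_rec: "v n + (of_nat k - 2) * v (n + 1) - (of_nat k - 1) * v (n + 2) = F n - of_real Q * F (n + 2)" for n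
  proof -
    let ?k = "of_nat k :: complex" and ?r = "of_nat r :: complex"
    \<comment> \<open>Here \<open>z\<close> is \<open>k\<close>, \<open>w\<close> and
      \<open>y\<close> are both \<open>r\<close>, \<open>a\<close> to \<open>d\<close> are
      \<open>F n\<close> to \<open>F (n + 3)\<close>, and \<open>t\<close> and \<open>s\<close> are
      the two tail sums at \<open>n + 4\<close>.\<close>
    have alg: "(a - (z - 2) * b - ((w - 1) * (z - 1) - 1) / z * (c + (d + t))
          - (y - z) / z * ((z - 1)\<^sup>2 * (c + - (z - 1) * (d + - (z - 1) * s))))
        + (z - 2) * (b - (z - 2) * c - ((w - 1) * (z - 1) - 1) / z * (d + t)
          - (y - z) / z * ((z - 1)\<^sup>2 * (d + - (z - 1) * s)))
        - (z - 1) * (c - (z - 2) * d - ((w - 1) * (z - 1) - 1) / z * t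
          - (y - z) / z * ((z - 1)\<^sup>2 * s))
        = a - (w - 1) * (z - 1) * c" if "z \<noteq> 0" "y = w" for z w y a b c d s t :: complex
      using that by (simp add: field_simps power2_eq_square)
    have steps: "tail_sum z F (n + 2) = F (n + 2) + z * (F (n + 3) + z * tail_sum z F (n + 4))"
        "tail_sum z F (n + 3) = F (n + 3) + z * tail_sum z F (n + 4)" for z
      using step[of z "n + 2"] step[of z "n + 3"] by (simp_all add: eval_nat_numeral)
    have n: "n + 1 + 1 = n + 2" "n + 1 + 2 = n + 3" "n + 2 + 1 = n + 3" "n + 2 + 2 = n + 4"
      by simp_all
    have Q: "of_real Q = (?r - 1) * (?k - 1)"
      by (simp add: Q_def)
    show ?thesis
      unfolding v_def n steps mult_1 of_real_divide of_real_diff of_real_1 of_real_of_nat_eq Q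
      using k2 by (intro alg) simp_all
  qed
  obtain K' where K': "\<And>n. K' \<le> n \<Longrightarrow> inv_abel g n = 0"
    by (rule inv_abel_support[OF assms]) blast
  have "inv_abel g n - v n = 0"
  proof (rule finite_support_rec_eq_0[of "max K K'" _ "of_nat k - 2" "of_nat k - 1"])
    show "inv_abel g n - v n = 0" if "max K K' \<le> n" for n
    proof -
      have "tail_sum z F (n + 2) = 0" for z
        using that by (intro tail_sum_eq_0[OF F0, of "n + 2"]; linarith)
      then show ?thesis
        using that K' F0 by (simp add: v_def)
    qed
    have FQ: "complex_of_real (Q powr (- real n / 2)) * (g (int n) - g (int n + 2)) = F n - of_real Q * F (n + 2)" for n
      unfolding F_def Q_powr_shift[symmetric, of n] by (simp add: algebra_simps)
    show "inv_abel g n - v n + (of_nat k - 2) * (inv_abel g (n + 1) - v (n + 1))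
        - (of_nat k - 1) * (inv_abel g (n + 2) - v (n + 2)) = 0" for n
    proof -
      have "inv_abel g n - v n + (of_nat k - 2) * (inv_abel g (n + 1) - v (n + 1))
          - (of_nat k - 1) * (inv_abel g (n + 2) - v (n + 2)) =
        (inv_abel g n + (of_nat k - 2) * inv_abel g (n + 1) - (of_nat k - 1) * inv_abel g (n + 2))
        - (v n + (of_nat k - 2) * v (n + 1) - (of_nat k - 1) * v (n + 2))"
        by (simp add: algebra_simps)
      then show ?thesis
        unfolding inv_abel_rec[OF assms] v_rec FQ by simp
    qed
  qed
  then show ?thesis using v by simp
qed

end

theorem proposition3p3:
  fixes k r :: nat and V :: "'v set" and E :: "'v set set" and x0 :: 'v
    and \<omega> :: "nat \<Rightarrow> 'v" and Q :: real
    and A :: "('v \<Rightarrow> complex) \<Rightarrow> int \<Rightarrow> complex"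
  assumes "2 \<le> k" and "2 \<le> r" and "k \<le> r"
    and "symmetric_graph k r V E" and "x0 \<in> V" and "\<omega> \<in> rays k V E x0"
    and Q: "Q = (real r - 1) * (real k - 1)"
    and A: "A = abel k r V E x0 \<omega>"
  shows "(\<forall>f1\<in>radial_funs k V E x0. \<forall>f2\<in>radial_funs k V E x0. \<forall>a b :: complex.
            A (\<lambda>x. a * f1 x + b * f2 x) = (\<lambda>h. a * A f1 h + b * A f2 h))
       \<and> bij_betw A (radial_funs k V E x0) even_funs
       \<and> (\<forall>g\<in>even_funs. \<forall>n::nat.
            radial_value k V E x0 (inv_into (radial_funs k V E x0) A g) n
              = 1 / of_nat k * of_real (Q powr (- (real n - 1) / 2)) *
                ((\<Sum>\<^sub>\<infinity>m\<in>{1::nat..}. of_real (Q powr (- real m / 2)) *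
                     (g (int n + int m - 1) - g (int n + int m + 1)))
               + (\<Sum>\<^sub>\<infinity>m\<in>{1::nat..}. (-1) ^ (m - 1) * (of_nat k - 1) ^ m *
                     of_real (Q powr (- real m / 2)) *
                     (g (int n + int m - 1) - g (int n + int m + 1))))
          \<and> radial_value k V E x0 (inv_into (radial_funs k V E x0) A g) n
              = of_real (Q powr (- real n / 2)) *
                (g (int n)
               - (of_nat k - 2) * of_real (Q powr (- 1 / 2)) * g (int n + 1)
               - of_real ((Q - 1) / real k) *
                   (\<Sum>\<^sub>\<infinity>m\<in>{2::nat..}. of_real (Q powr (- real m / 2)) * g (int n + int m))
               - of_real ((real r - real k) / real k) *
                   (\<Sum>\<^sub>\<infinity>m\<in>{2::nat..}. (-1) ^ m * (of_nat k - 1) ^ m *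
                     of_real (Q powr (- real m / 2)) * g (int n + int m))))"
proof -
  interpret polygon_graph_ray k r V E x0 \<omega>
    using assms by unfold_locales
  \<comment> \<open>The variable \<open>Q\<close> of the theorem hides the constant of the locale,
    which depends only on \<open>k\<close> and \<open>r\<close>.\<close>
  have QQ: "Q = polygon_graph_ray.Q k r"
    by (simp add: Q Q_def)
  have inv: "radial_value k V E x0 (inv_into (radial_funs k V E x0) A g) n = inv_abel g n"
    if g: "g \<in> even_funs" for g n
  proof -
    have "A ` radial_funs k V E x0 = even_funs"
      using abel_bij by (simp add: A bij_betw_def)
    \<comment> \<open>By surjectivity \<open>inv_into\<close> picks a radial preimage of
      \<open>g\<close>, to which \<open>abel_inverse\<close> applies.\<close>
    then have f: "inv_into (radial_funs k V E x0) A g \<in> radial_funs k V E x0"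
        "A (inv_into (radial_funs k V E x0) A g) = g"
      using g inv_into_into f_inv_into_f by metis+
    show ?thesis
      using radial_value_eq[OF f(1)] abel_inverse[OF f(1)] f(2) by (simp add: A)
  qed
  show ?thesis
  proof (intro conjI ballI allI)
    show "A (\<lambda>x. a * f1 x + b * f2 x) = (\<lambda>h. a * A f1 h + b * A f2 h)"
      if "f1 \<in> radial_funs k V E x0" "f2 \<in> radial_funs k V E x0" for f1 f2 a b
      unfolding A using that by (rule abel_linear)
    show "bij_betw A (radial_funs k V E x0) even_funs"
      unfolding A by (rule abel_bij)
  next
    fix g :: "int \<Rightarrow> complex" and n :: nat assume g: "g \<in> even_funs"
    show "radial_value k V E x0 (inv_into (radial_funs k V E x0) A g) n
              = 1 / of_nat k * of_real (Q powr (- (real n - 1) / 2)) *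
                ((\<Sum>\<^sub>\<infinity>m\<in>{1::nat..}. of_real (Q powr (- real m / 2)) *
                     (g (int n + int m - 1) - g (int n + int m + 1)))
               + (\<Sum>\<^sub>\<infinity>m\<in>{1::nat..}. (-1) ^ (m - 1) * (of_nat k - 1) ^ m *
                     of_real (Q powr (- real m / 2)) *
                     (g (int n + int m - 1) - g (int n + int m + 1))))"
      unfolding inv[OF g] QQ by (rule inv_abel_eq1)
    show "radial_value k V E x0 (inv_into (radial_funs k V E x0) A g) n
              = of_real (Q powr (- real n / 2)) *
                (g (int n)
               - (of_nat k - 2) * of_real (Q powr (- 1 / 2)) * g (int n + 1)
               - of_real ((Q - 1) / real k) *
                   (\<Sum>\<^sub>\<infinity>m\<in>{2::nat..}. of_real (Q powr (- real m / 2)) * g (int n + int m))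
               - of_real ((real r - real k) / real k) *
                   (\<Sum>\<^sub>\<infinity>m\<in>{2::nat..}. (-1) ^ m * (of_nat k - 1) ^ m *
                     of_real (Q powr (- real m / 2)) * g (int n + int m)))"
      unfolding inv[OF g] QQ by (rule inv_abel_eq2[OF g])
  qed
qed

end
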